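(* Let $\theta_0 > \theta_1 > \theta_2$ and let $\Gamma$ be an $n$-vertex non-bipartite graph in $\mathcal{G}(\theta_0,\theta_1,\theta_2)$. Let $k_{\max}$ be the maximal valency in $\Gamma$ and let $\ell := \min\{\, 1-(\theta_1+1)(\theta_2+1),\ -\theta_1\theta_2+1 \,\}$. Then the following hold: (i) $k_{\max} \leq (1-(\theta_1+1)(\theta_2+1))^2 - \theta_1\theta_2$; (ii) if the complement of $\Gamma$ is connected, then $k_{\max} \leq \ell^2 - \theta_1\theta_2$; (iii) $n \leq \max\{\, (\ell^2 - \theta_1\theta_2 - 1)^2 + 1,\ (1-(\theta_1+1)(\theta_2+1))^2 - \theta_1\theta_2 + 1 \,\}$.
   Context: All graphs are finite and simple; eigenvalues of a graph are those of its adjacency matrix; valency means degree. For $\theta_0 > \theta_1 > \theta_2$, $\mathcal{G}(\theta_0,\theta_1,\theta_2)$ denotes the set of connected nonregular graphs having precisely three distinct eigenvalues $\theta_0$, $\theta_1$, $\theta_2$. *)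

theory Defs
  imports "Graph_Theory.Graph_Theory" "Jordan_Normal_Form.Spectral_Radius"
begin

text \<open>
  A finite simple graph is a \<^locale>\<open>pair_graph\<close>: a finite vertex set together with a symmetric,
  irreflexive set of ordered pairs of vertices.  An edge \<open>{u, v}\<close> is represented by the two arcs
  \<open>(u, v)\<close> and \<open>(v, u)\<close>, so the valency of a vertex is its out-degree.
\<close>

abbreviation valency :: "'a pair_pre_digraph \<Rightarrow> 'a \<Rightarrow> nat" where
  "valency G v \<equiv> out_degree (with_proj G) v"

definition max_valency :: "'a pair_pre_digraph \<Rightarrow> nat" where
  "max_valency G = Max (valency G ` pverts G)"

definition regular_graph :: "'a pair_pre_digraph \<Rightarrow> bool" where
  "regular_graph G \<longleftrightarrow> (\<exists>k. \<forall>v \<in> pverts G. valency G v = k)"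

abbreviation connected_graph :: "'a pair_pre_digraph \<Rightarrow> bool" where
  "connected_graph G \<equiv> Digraph_Component.connected (with_proj G)"

definition bipartite_graph :: "'a pair_pre_digraph \<Rightarrow> bool" where
  "bipartite_graph G \<longleftrightarrow>
     (\<exists>X Y. X \<union> Y = pverts G \<and> X \<inter> Y = {} \<and> parcs G \<subseteq> X \<times> Y \<union> Y \<times> X)"

definition complement_graph :: "'a pair_pre_digraph \<Rightarrow> 'a pair_pre_digraph" where
  "complement_graph G =
     \<lparr> pverts = pverts G,
       parcs = {(u, v). u \<in> pverts G \<and> v \<in> pverts G \<and> u \<noteq> v \<and> (u, v) \<notin> parcs G} \<rparr>"

text \<open>
  Matrices are indexed by natural numbers, so the adjacency matrix is taken with respect to an
  enumeration of the vertices.  Another enumeration conjugates the matrix by a permutation matrix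
  and leaves the spectrum unchanged; hence the arbitrary choice in \<open>graph_spectrum\<close>.
  The matrix is real and symmetric, so its real eigenvalues are all its eigenvalues.
\<close>

definition adjacency_matrix :: "'a pair_pre_digraph \<Rightarrow> 'a list \<Rightarrow> real mat" where
  "adjacency_matrix G vs =
     mat (length vs) (length vs) (\<lambda>(i, j). if (vs ! i, vs ! j) \<in> parcs G then 1 else 0)"

definition graph_spectrum :: "'a pair_pre_digraph \<Rightarrow> real set" where
  "graph_spectrum G =
     spectrum (adjacency_matrix G (SOME vs. distinct vs \<and> set vs = pverts G))"

definition three_eigenvalue_graphs :: "real \<Rightarrow> real \<Rightarrow> real \<Rightarrow> 'a pair_pre_digraph set" where
  "three_eigenvalue_graphs \<theta>\<^sub>0 \<theta>\<^sub>1 \<theta>\<^sub>2 =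
     {G. pair_graph G \<and> connected_graph G \<and> \<not> regular_graph G \<and>
         graph_spectrum G = {\<theta>\<^sub>0, \<theta>\<^sub>1, \<theta>\<^sub>2}}"

end

theory Submission
  imports Defs
begin

text \<open>
  Let \<open>A\<close> be the adjacency matrix.  By Perron-Frobenius \<open>(A - \<theta>\<^sub>1)(A - \<theta>\<^sub>2) = \<alpha> \<alpha>\<^sup>T\<close> for a positive
  \<open>\<theta>\<^sub>0\<close>-eigenvector \<open>\<alpha>\<close>.  Comparing entries, \<open>\<alpha>\<^sub>x\<^sup>2\<close> is the valency of \<open>x\<close> plus \<open>\<theta>\<^sub>1\<theta>\<^sub>2\<close>, and \<open>\<alpha>\<^sub>x\<alpha>\<^sub>y\<close> is
  the number of common neighbours, minus \<open>\<theta>\<^sub>1 + \<theta>\<^sub>2\<close> if \<open>x\<close> and \<open>y\<close> are adjacent.  In the non-bipartite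
  case \<open>\<theta>\<^sub>1 + \<theta>\<^sub>2\<close> and \<open>\<theta>\<^sub>1\<theta>\<^sub>2\<close> are integers, so \<open>\<alpha>\<^sub>y < \<alpha>\<^sub>x\<close> forces \<open>\<alpha>\<^sub>y \<ge> 1\<close> and \<open>\<alpha>\<^sub>x - \<alpha>\<^sub>y \<ge> 1\<close>, whence
  \<open>\<alpha>\<^sub>x - 1 \<le> \<alpha>\<^sub>y(\<alpha>\<^sub>x - \<alpha>\<^sub>y)\<close>.  The right-hand side is at most \<open>-(\<theta>\<^sub>1 + 1)(\<theta>\<^sub>2 + 1)\<close> for adjacent and at most
  \<open>-\<theta>\<^sub>1\<theta>\<^sub>2\<close> for nonadjacent \<open>x\<close>, \<open>y\<close>; apply this to a vertex \<open>x\<close> of maximal and a vertex \<open>y\<close> of smaller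
  valency.  As the diameter is 2, the order is bounded by counting from a vertex of smaller valency,
  unless the graph is the join of its vertices of maximal valency with the other ones.  Such a
  join, without a dominating vertex, can only occur if \<open>\<alpha>\<close> takes exactly three values, and the order is
  then bounded directly.
\<close>

section \<open>Symmetric matrices\<close>

definition mat_trace :: "'a::comm_ring_1 mat \<Rightarrow> 'a" where
  "mat_trace A = (\<Sum>i<dim_row A. A $$ (i, i))"

lemma mat_trace_commute:
  assumes A: "A \<in> carrier_mat n n" and B: "B \<in> carrier_mat n n"
  shows "mat_trace (A * B) = mat_trace (B * A)"
proof -
  have "mat_trace (A * B) = (\<Sum>i<n. \<Sum>j<n. A $$ (i, j) * B $$ (j, i))"
    using A B by (auto simp: mat_trace_def scalar_prod_def lessThan_atLeast0 intro!: sum.cong)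
  also have "\<dots> = (\<Sum>j<n. \<Sum>i<n. A $$ (i, j) * B $$ (j, i))"
    by (rule sum.swap)
  also have "\<dots> = mat_trace (B * A)"
    using A B
    by (auto simp: mat_trace_def scalar_prod_def lessThan_atLeast0 mult.commute intro!: sum.cong)
  finally show ?thesis .
qed

lemma mat_trace_conjugate:
  assumes "P \<in> carrier_mat n n" "Q \<in> carrier_mat n n" "T \<in> carrier_mat n n" "Q * P = 1\<^sub>m n"
  shows "mat_trace (P * T * Q) = mat_trace T"
proof -
  have "mat_trace (P * T * Q) = mat_trace (Q * (P * T))"
    using assms by (intro mat_trace_commute) auto
  also have "Q * (P * T) = (Q * P) * T"
    using assms by (metis assoc_mult_mat)
  finally show ?thesis using assms by simp
qed

lemma mult_conjugates:
  assumes "P \<in> carrier_mat n n" "Q \<in> carrier_mat n n" "S \<in> carrier_mat n n" "T \<in> carrier_mat n n"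
    and "Q * P = 1\<^sub>m n"
  shows "(P * S * Q) * (P * T * Q) = P * (S * T) * (Q :: 'a::comm_ring_1 mat)"
proof -
  have "(P * S * Q) * (P * T * Q) = P * (S * ((Q * P) * (T * Q)))"
    using assms(1-4) by (simp add: assoc_mult_mat[of _ n n _ n _ n])
  also have "\<dots> = P * (S * T) * Q"
    using assms by (simp add: assoc_mult_mat[of _ n n _ n _ n])
  finally show ?thesis .
qed

lemma shift_conjugate:
  assumes "P \<in> carrier_mat n n" "Q \<in> carrier_mat n n" "T \<in> carrier_mat n n" "P * Q = 1\<^sub>m n"
  shows "P * T * Q - c \<cdot>\<^sub>m 1\<^sub>m n = P * (T - c \<cdot>\<^sub>m 1\<^sub>m n) * (Q :: 'a::comm_ring_1 mat)"
proof -
  have "P * (T - c \<cdot>\<^sub>m 1\<^sub>m n) = P * T - c \<cdot>\<^sub>m P"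
    using assms by (subst mult_minus_distrib_mat[of _ n n _ n]) auto
  also have "(P * T - c \<cdot>\<^sub>m P) * Q = P * T * Q - c \<cdot>\<^sub>m (P * Q)"
    using assms
    by (subst minus_mult_distrib_mat[of _ n n _ _ n]) (auto simp: mult_smult_assoc_mat[of _ n n _ n])
  finally show ?thesis using assms by simp
qed

lemma upper_triangular_mult:
  assumes A: "A \<in> carrier_mat n n" and B: "B \<in> carrier_mat n n"
    and UA: "upper_triangular A" and UB: "upper_triangular (B :: 'a::comm_ring_1 mat)"
  shows "upper_triangular (A * B)"
    and "i < n \<Longrightarrow> (A * B) $$ (i, i) = A $$ (i, i) * B $$ (i, i)"
proof -
  have entry: "(A * B) $$ (i, j) = (\<Sum>k<n. A $$ (i, k) * B $$ (k, j))" if "i < n" "j < n" for i j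
    using A B that by (auto simp: scalar_prod_def lessThan_atLeast0)
  have zero: "A $$ (i, k) * B $$ (k, j) = 0" if "i < n" "k < n" "j < n" "k < i \<or> j < k" for i j k
    using that A B upper_triangularD[OF UA, of k i] upper_triangularD[OF UB, of j k] by auto
  show "upper_triangular (A * B)"
  proof (rule upper_triangularI)
    fix i j assume "j < i" "i < dim_row (A * B)"
    then show "(A * B) $$ (i, j) = 0"
      using A zero[of i _ j] by (simp add: entry) (force intro!: sum.neutral)
  qed
  show "(A * B) $$ (i, i) = A $$ (i, i) * B $$ (i, i)" if i: "i < n"
  proof -
    have "(A * B) $$ (i, i) = (\<Sum>k\<in>{i}. A $$ (i, k) * B $$ (k, i))"
      unfolding entry[OF i i] using i zero[OF i _ i]
      by (intro sum.mono_neutral_right) (auto simp: nat_neq_iff)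
    then show ?thesis by simp
  qed
qed

lemma upper_triangular_shift:
  assumes "A \<in> carrier_mat n n" "upper_triangular (A :: 'a::comm_ring_1 mat)"
  shows "upper_triangular (A - c \<cdot>\<^sub>m 1\<^sub>m n)"
  using assms by (intro upper_triangularI) auto

text \<open>The Hermitian form \<open>q\<close> of the eigenvector equals \<open>z * r\<close> with
  \<open>r\<close> its squared norm; symmetry makes \<open>q\<close> real, and \<open>r\<close> is
  real and nonzero.\<close>

lemma symmetric_complex_eigenvalue_real:
  fixes A :: "real mat"
  assumes A: "A \<in> carrier_mat n n" and sym: "\<And>i j. i < n \<Longrightarrow> j < n \<Longrightarrow> A $$ (i, j) = A $$ (j, i)"
    and ev: "eigenvalue (map_mat complex_of_real A) z"
  shows "z \<in> \<real>"
proof -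
  let ?C = "map_mat complex_of_real A"
  from ev obtain v where v: "v \<in> carrier_vec n" "v \<noteq> 0\<^sub>v n" and Cv: "?C *\<^sub>v v = z \<cdot>\<^sub>v v"
    using A unfolding eigenvalue_def eigenvector_def by auto
  have row: "(\<Sum>j<n. of_real (A $$ (i, j)) * v $ j) = z * v $ i" if "i < n" for i
  proof -
    have "(?C *\<^sub>v v) $ i = (\<Sum>j<n. of_real (A $$ (i, j)) * v $ j)"
      using A v(1) that by (auto simp: scalar_prod_def lessThan_atLeast0)
    then show ?thesis using Cv v(1) that by simp
  qed
  define q where "q = (\<Sum>i<n. \<Sum>j<n. of_real (A $$ (i, j)) * (cnj (v $ i) * v $ j))"
  define r where "r = (\<Sum>i<n. cnj (v $ i) * v $ i)"
  have "q = (\<Sum>i<n. cnj (v $ i) * (\<Sum>j<n. of_real (A $$ (i, j)) * v $ j))"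
    unfolding q_def by (simp add: sum_distrib_left mult_ac)
  also have "\<dots> = (\<Sum>i<n. cnj (v $ i) * (z * v $ i))"
    by (intro sum.cong refl) (simp add: row)
  also have "\<dots> = z * r"
    by (simp add: r_def sum_distrib_left mult_ac)
  finally have q: "q = z * r" .
  have "cnj q = (\<Sum>i<n. \<Sum>j<n. of_real (A $$ (i, j)) * (v $ i * cnj (v $ j)))"
    unfolding q_def by simp
  also have "\<dots> = (\<Sum>j<n. \<Sum>i<n. of_real (A $$ (i, j)) * (v $ i * cnj (v $ j)))"
    by (rule sum.swap)
  also have "\<dots> = q"
    unfolding q_def using sym by (auto intro!: sum.cong simp: mult_ac)
  finally have qr: "cnj q = q" .
  have rr: "r = of_real (\<Sum>i<n. (cmod (v $ i))\<^sup>2)"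
    unfolding r_def of_real_sum
    by (intro sum.cong refl) (simp add: complex_norm_square mult.commute del: of_real_power)
  obtain k where k: "k < n" "v $ k \<noteq> 0"
    using v by (metis carrier_vecD eq_vecI index_zero_vec(1) index_zero_vec(2))
  have "(\<Sum>i<n. (cmod (v $ i))\<^sup>2) > 0"
    using k by (intro sum_pos2[of _ k]) auto
  then have "r \<noteq> 0" unfolding rr by (metis of_real_eq_0_iff less_irrefl)
  moreover have "cnj r = r" unfolding rr by simp
  ultimately have "cnj z = z" using q qr by (metis complex_cnj_mult mult_right_cancel)
  then show ?thesis by (simp add: Reals_cnj_iff)
qed

text \<open>The characteristic polynomial splits over the complex numbers with real roots only, and
  injectivity of the coefficient embedding pulls the factorization back.\<close>

lemma symmetric_char_poly_splits:
  fixes A :: "real mat"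
  assumes A: "A \<in> carrier_mat n n" and sym: "\<And>i j. i < n \<Longrightarrow> j < n \<Longrightarrow> A $$ (i, j) = A $$ (j, i)"
  obtains es where "char_poly A = (\<Prod>e\<leftarrow>es. [:- e, 1:])" "set es \<subseteq> spectrum A"
proof -
  let ?C = "map_mat complex_of_real A"
  have C: "?C \<in> carrier_mat n n" using A by simp
  obtain as where as: "char_poly ?C = (\<Prod>a\<leftarrow>as. [:- a, 1:])"
    using char_poly_factorized[OF C] by blast
  have "a \<in> \<real>" if "a \<in> set as" for a
  proof -
    have "poly (char_poly ?C) a = 0" unfolding as using linear_poly_root[OF that] .
    then have "eigenvalue ?C a" using eigenvalue_root_char_poly[OF C] by simp
    then show ?thesis using symmetric_complex_eigenvalue_real[OF A sym] by blast
  qed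
  then have as_real: "as = map of_real (map Re as)"
    by (induction as) (auto elim!: Reals_cases)
  have hom: "char_poly ?C = map_poly of_real (char_poly A)"
    by (rule of_real_hom.char_poly_hom[OF A])
  interpret h: map_poly_inj_comm_ring_hom "of_real :: real \<Rightarrow> complex" ..
  have "map_poly of_real (\<Prod>e\<leftarrow>es. [:- e, 1:]) = (\<Prod>a\<leftarrow>map complex_of_real es. [:- a, 1:])"
    for es :: "real list"
    by (induction es) (simp_all add: h.hom_mult del: mult_pCons_left)
  then have "map_poly complex_of_real (char_poly A) =
      map_poly complex_of_real (\<Prod>e\<leftarrow>map Re as. [:- e, 1:])"
    using as hom as_real by metis
  then have cp: "char_poly A = (\<Prod>e\<leftarrow>map Re as. [:- e, 1:])"
    by (simp only: h.eq_iff)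
  have "e \<in> spectrum A" if "e \<in> set (map Re as)" for e
    unfolding spectrum_root_char_poly[OF A] mem_Collect_eq cp using linear_poly_root[OF that] .
  then show ?thesis using that cp by blast
qed

text \<open>Schur triangularization takes the place of diagonalization. The trace of
  \<open>?N * transpose_mat ?N\<close> is the sum of the squared entries of \<open>?N\<close>. In
  triangular form each diagonal entry of this product has the factor (t - a)(t - b)(t - c) with t an
  eigenvalue, so the trace is 0.\<close>

lemma symmetric_three_eigenvalues_annihilates:
  fixes A :: "real mat"
  assumes A: "A \<in> carrier_mat n n" and sym: "\<And>i j. i < n \<Longrightarrow> j < n \<Longrightarrow> A $$ (i, j) = A $$ (j, i)"
    and spec: "spectrum A \<subseteq> {a, b, c}"
  shows "(A - a \<cdot>\<^sub>m 1\<^sub>m n) * (A - b \<cdot>\<^sub>m 1\<^sub>m n) * (A - c \<cdot>\<^sub>m 1\<^sub>m n) = 0\<^sub>m n n"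
proof -
  obtain es where cp: "char_poly A = (\<Prod>e\<leftarrow>es. [:- e, 1:])" and es: "set es \<subseteq> spectrum A"
    using symmetric_char_poly_splits[OF A sym] .
  obtain T P Q where schur: "schur_decomposition A es = (T, P, Q)"
    by (cases "schur_decomposition A es")
  have sim: "similar_mat_wit A T P Q" and UT: "upper_triangular T" and diag: "diag_mat T = es"
    using schur_decomposition[OF A cp schur] by auto
  note w = similar_mat_witD2[OF A sim]
  have diag_root: "T $$ (i, i) \<in> {a, b, c}" if "i < n" for i
  proof -
    have "T $$ (i, i) \<in> set (diag_mat T)" using that w(5) by (auto simp: diag_mat_def)
    then show ?thesis using diag es spec by auto
  qed
  define s where "s X x = X - x \<cdot>\<^sub>m 1\<^sub>m n" for X :: "real mat" and x
  have s_carrier: "s X x \<in> carrier_mat n n" for X x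
    unfolding s_def by (intro minus_carrier_mat) simp
  have s_conj: "s A x = P * s T x * Q" for x
    unfolding s_def using shift_conjugate[OF w(6,7,5,1), of x] w(3) by simp
  have s_tri: "upper_triangular (s T x)" for x
    unfolding s_def by (rule upper_triangular_shift[OF w(5) UT])
  have s_diag: "s T x $$ (i, i) = T $$ (i, i) - x" if "i < n" for x i
    using that w(5) by (simp add: s_def)
  have s_sym: "transpose_mat (s A x) = s A x" for x
    using A sym by (intro eq_matI) (auto simp: s_def)
  note mc = mult_carrier_mat[of _ n n _ n]
  let ?N = "s A a * s A b * s A c"
  let ?M = "s T a * s T b * s T c"
  let ?M' = "s T c * (s T b * s T a)"
  have N: "?N \<in> carrier_mat n n" by (intro mc s_carrier)
  have M: "?M \<in> carrier_mat n n" "?M' \<in> carrier_mat n n" by (intro mc s_carrier)+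
  note conj = mult_conjugates[OF w(6,7) _ _ w(2)]
  have N_conj: "?N = P * ?M * Q"
    unfolding s_conj by (simp add: conj mc s_carrier)
  \<comment> \<open>Transposing a product of symmetric factors reverses their order, so the
    transpose is again a conjugate by \<open>P\<close> and \<open>Q\<close> of a triangular
    matrix.\<close>
  have "transpose_mat ?N = s A c * (s A b * s A a)"
    using s_carrier by (simp add: transpose_mult[of _ n n _ n] mc s_sym)
  also have "\<dots> = P * ?M' * Q"
    unfolding s_conj by (simp add: conj mc s_carrier)
  finally have "mat_trace (?N * transpose_mat ?N) = mat_trace (P * (?M * ?M') * Q)"
    using M N_conj by (simp add: conj)
  also have "\<dots> = mat_trace (?M * ?M')"
    using M by (intro mat_trace_conjugate[OF w(6,7) _ w(2)]) (auto intro: mc)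
  also have "\<dots> = 0"
  proof -
    have "(?M * ?M') $$ (i, i) = 0" if i: "i < n" for i
    proof -
      note um = upper_triangular_mult[of _ n]
      have "(?M * ?M') $$ (i, i) = ?M $$ (i, i) * ?M' $$ (i, i)"
        using M i by (intro um(2)) (auto intro!: um(1) mc s_carrier s_tri)
      also have "?M $$ (i, i) = (T $$ (i, i) - a) * (T $$ (i, i) - b) * (T $$ (i, i) - c)"
        using i by (simp add: um mc s_carrier s_tri s_diag del: index_mult_mat)
      finally show ?thesis using diag_root[OF i] by auto
    qed
    then show ?thesis using M unfolding mat_trace_def by (intro sum.neutral) auto
  qed
  finally have "mat_trace (?N * transpose_mat ?N) = 0" .
  moreover have "mat_trace (?N * transpose_mat ?N) = (\<Sum>i<n. \<Sum>j<n. (?N $$ (i, j))\<^sup>2)"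
    using N unfolding mat_trace_def
    by (auto simp del: index_mult_mat(1) simp: index_mult_mat(1)[of _ ?N] scalar_prod_def power2_eq_square lessThan_atLeast0 intro!: sum.cong)
  ultimately have *: "(\<Sum>i<n. \<Sum>j<n. (?N $$ (i, j))\<^sup>2) = 0" by simp
  have "?N $$ (i, j) = 0" if "i < n" "j < n" for i j
  proof -
    have "(\<Sum>j<n. (?N $$ (i, j))\<^sup>2) = 0"
      using * that by (subst (asm) sum_nonneg_eq_0_iff) (auto intro!: sum_nonneg)
    then show ?thesis using that by (subst (asm) sum_nonneg_eq_0_iff) auto
  qed
  then have "?N = 0\<^sub>m n n" using N by (intro eq_matI) auto
  then show ?thesis by (simp add: s_def)
qed

section \<open>The Perron vector of a graph with three eigenvalues\<close>

locale neighbourhood_graph =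
  fixes V :: "'a set" and N :: "'a \<Rightarrow> 'a set"
  assumes finite_V: "finite V"
    and N_subset: "x \<in> V \<Longrightarrow> N x \<subseteq> V"
    and N_sym: "x \<in> V \<Longrightarrow> y \<in> V \<Longrightarrow> y \<in> N x \<longleftrightarrow> x \<in> N y"
    and N_irrefl: "x \<in> V \<Longrightarrow> x \<notin> N x"
begin

definition adj :: "('a \<Rightarrow> real) \<Rightarrow> 'a \<Rightarrow> real" where
  "adj f x = (\<Sum>y\<in>N x. f y)"

definition ip :: "('a \<Rightarrow> real) \<Rightarrow> ('a \<Rightarrow> real) \<Rightarrow> real" where
  "ip f g = (\<Sum>x\<in>V. f x * g x)"

definition eigfun :: "real \<Rightarrow> ('a \<Rightarrow> real) \<Rightarrow> bool" where
  "eigfun c f \<longleftrightarrow> (\<forall>x\<in>V. adj f x = c * f x)"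

definition unit_fun :: "'a \<Rightarrow> 'a \<Rightarrow> real" where
  "unit_fun y x = (if x = y then 1 else 0)"

lemma finite_N: "x \<in> V \<Longrightarrow> finite (N x)"
  using N_subset finite_V finite_subset by blast

lemma adj_cong: "x \<in> V \<Longrightarrow> (\<And>y. y \<in> V \<Longrightarrow> f y = g y) \<Longrightarrow> adj f x = adj g x"
  unfolding adj_def using N_subset by (intro sum.cong) auto

lemma ip_cong:
  "(\<And>x. x \<in> V \<Longrightarrow> f x = f' x) \<Longrightarrow> (\<And>x. x \<in> V \<Longrightarrow> g x = g' x) \<Longrightarrow> ip f g = ip f' g'"
  unfolding ip_def by (intro sum.cong) auto

lemma adj_linear [simp]:
  "adj (\<lambda>x. f x + g x) y = adj f y + adj g y"
  "adj (\<lambda>x. f x - g x) y = adj f y - adj g y"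
  "adj (\<lambda>x. c * f x) y = c * adj f y"
  by (simp_all add: adj_def sum.distrib sum_subtractf sum_distrib_left)

lemma ip_linear:
  "ip (\<lambda>x. f x + g x) h = ip f h + ip g h"
  "ip f (\<lambda>x. g x + h x) = ip f g + ip f h"
  "ip f (\<lambda>x. c * g x) = c * ip f g"
  "ip (\<lambda>x. c * f x) g = c * ip f g"
  by (simp_all add: ip_def sum.distrib sum_distrib_left algebra_simps)

lemma ip_commute: "ip f g = ip g f"
  by (simp add: ip_def mult.commute)

lemma ip_nonneg: "ip f f \<ge> 0"
  unfolding ip_def by (intro sum_nonneg) simp

lemma ip_self_eq_0: "ip f f = 0 \<Longrightarrow> x \<in> V \<Longrightarrow> f x = 0"
  unfolding ip_def using finite_V by (subst (asm) sum_nonneg_eq_0_iff) auto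

lemma adj_self_adjoint: "ip f (adj g) = ip (adj f) g"
proof -
  have ext: "adj h x = (\<Sum>y\<in>V. if y \<in> N x then h y else 0)" if "x \<in> V" for h x
  proof -
    have "(\<Sum>y\<in>V. if y \<in> N x then h y else 0) = sum h (V \<inter> N x)"
      using finite_V by (simp add: sum.inter_restrict)
    also have "V \<inter> N x = N x" using N_subset[OF that] by blast
    finally show ?thesis by (simp add: adj_def)
  qed
  have "ip f (adj g) = (\<Sum>x\<in>V. \<Sum>y\<in>V. if y \<in> N x then f x * g y else 0)"
    unfolding ip_def by (intro sum.cong refl) (simp add: ext sum_distrib_left if_distrib cong: if_cong)
  also have "\<dots> = (\<Sum>y\<in>V. \<Sum>x\<in>V. if y \<in> N x then f x * g y else 0)"
    by (rule sum.swap)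
  also have "\<dots> = (\<Sum>y\<in>V. (\<Sum>x\<in>V. if x \<in> N y then f x else 0) * g y)"
    by (intro sum.cong refl) (auto simp: sum_distrib_right N_sym intro!: sum.cong)
  also have "\<dots> = ip (adj f) g"
    unfolding ip_def by (intro sum.cong refl) (simp add: ext)
  finally show ?thesis .
qed

lemma eigfun_orthogonal:
  assumes "eigfun c f" "eigfun d g" "c \<noteq> d"
  shows "ip f g = 0"
proof -
  have "ip f (adj g) = d * ip f g"
    using assms(2) unfolding eigfun_def ip_linear(3)[symmetric] by (intro ip_cong) auto
  moreover have "ip (adj f) g = c * ip f g"
    using assms(1) unfolding eigfun_def ip_linear(4)[symmetric] by (intro ip_cong) auto
  ultimately show ?thesis using adj_self_adjoint[of f g] assms(3) by simp
qed

lemma adj_unit_fun: "x \<in> V \<Longrightarrow> adj (unit_fun y) x = (if y \<in> N x then 1 else 0)"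
  using finite_N by (simp add: adj_def unit_fun_def if_distrib)

text \<open>An entry of the squared adjacency matrix, counting walks of length 2.\<close>

lemma adj_adj_unit_fun:
  assumes "x \<in> V" "y \<in> V"
  shows "adj (adj (unit_fun y)) x = card (N x \<inter> N y)"
proof -
  have "adj (unit_fun y) z = (if z \<in> N y then 1 else 0)" if "z \<in> N x" for z
  proof -
    have "z \<in> V" using N_subset assms(1) that by blast
    then show ?thesis using N_sym[OF \<open>z \<in> V\<close> assms(2)] adj_unit_fun by simp
  qed
  then have "adj (adj (unit_fun y)) x = (\<Sum>z\<in>N x. if z \<in> N y then 1 else 0)"
    unfolding adj_def[of "adj _"] by simp
  then show ?thesis using finite_N[OF assms(1)] by (simp add: sum.If_cases Int_def)
qed

end

text \<open>\<open>annihilates\<close> is (A - a)(A - b)(A - c) = 0, multiplied out and applied to a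
  function.\<close>

locale three_eigenvalue_nbh = neighbourhood_graph +
  fixes a b c :: real
  assumes ab: "a > b" and bc: "b > c"
    and connected: "\<And>S. S \<subseteq> V \<Longrightarrow> S \<noteq> {} \<Longrightarrow> (\<And>x. x \<in> S \<Longrightarrow> N x \<subseteq> S) \<Longrightarrow> S = V"
    and annihilates: "\<And>f x. x \<in> V \<Longrightarrow>
      adj (adj (adj f)) x = (a + b + c) * adj (adj f) x - (a * b + a * c + b * c) * adj f x + a * b * c * f x"
    and eigfun_exists: "\<exists>h. eigfun a h \<and> (\<exists>x\<in>V. h x \<noteq> 0)"
begin

text \<open>The Lagrange polynomial (A - q)(A - r) / ((p - q)(p - r)): the projection onto the
  eigenspace of \<open>p\<close> when \<open>p\<close>, \<open>q\<close>, \<open>r\<close> are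
  \<open>a\<close>, \<open>b\<close>, \<open>c\<close> in some order.\<close>

definition proj :: "real \<Rightarrow> real \<Rightarrow> real \<Rightarrow> ('a \<Rightarrow> real) \<Rightarrow> 'a \<Rightarrow> real" where
  "proj p q r f x = 1 / ((p - q) * (p - r)) * (adj (adj f) x - (q + r) * adj f x + q * r * f x)"

text \<open>The three Lagrange polynomials sum to 1. Their coefficients are compared after
  multiplication by the Vandermonde product \<open>D\<close>.\<close>

lemma proj_sum: "proj a b c f x + (proj b a c f x + proj c a b f x) = f x"
proof -
  define k0 k1 k2 where k: "k0 = 1 / ((a - b) * (a - c))" "k1 = 1 / ((b - a) * (b - c))"
    "k2 = 1 / ((c - a) * (c - b))"
  define D where "D = (a - b) * (a - c) * (b - c)"
  have D: "D \<noteq> 0" unfolding D_def using ab bc by simp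
  have Dk: "D * k0 = b - c" "D * k1 = c - a" "D * k2 = a - b"
    unfolding D_def k using ab bc by (simp_all add: divide_simps) (simp_all add: algebra_simps)
  have "D * (k0 + k1 + k2) = D * k0 + D * k1 + D * k2"
    by (simp add: algebra_simps)
  also have "\<dots> = 0" unfolding Dk by simp
  finally have 1: "k0 + k1 + k2 = 0" using D by simp
  have "D * (k0 * (b + c) + k1 * (a + c) + k2 * (a + b)) =
      D * k0 * (b + c) + D * k1 * (a + c) + D * k2 * (a + b)"
    by (simp add: algebra_simps)
  also have "\<dots> = 0" unfolding Dk by (simp add: algebra_simps)
  finally have 2: "k0 * (b + c) + k1 * (a + c) + k2 * (a + b) = 0" using D by simp
  have "D * (k0 * (b * c) + k1 * (a * c) + k2 * (a * b)) =
      D * k0 * (b * c) + D * k1 * (a * c) + D * k2 * (a * b)"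
    by (simp add: algebra_simps)
  also have "\<dots> = (b - c) * (b * c) + (c - a) * (a * c) + (a - b) * (a * b)"
    unfolding Dk ..
  also have "\<dots> = D * 1" unfolding D_def by (simp add: algebra_simps)
  finally have 3: "k0 * (b * c) + k1 * (a * c) + k2 * (a * b) = 1" using D by simp
  have "proj a b c f x + (proj b a c f x + proj c a b f x) =
      (k0 + k1 + k2) * adj (adj f) x - (k0 * (b + c) + k1 * (a + c) + k2 * (a + b)) * adj f x
      + (k0 * (b * c) + k1 * (a * c) + k2 * (a * b)) * f x"
    unfolding proj_def k[symmetric] by (simp add: algebra_simps)
  then show ?thesis unfolding 1 2 3 by simp
qed

lemma eigfun_proj:
  "eigfun a (proj a b c f)" "eigfun b (proj b a c f)" "eigfun c (proj c a b f)"
proof -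
  have "adj (proj p q r f) x = 1 / ((p - q) * (p - r)) *
      (adj (adj (adj f)) x - (q + r) * adj (adj f) x + q * r * adj f x)" for p q r x
    unfolding proj_def adj_linear by simp
  then show "eigfun a (proj a b c f)" "eigfun b (proj b a c f)" "eigfun c (proj c a b f)"
    unfolding eigfun_def by (simp_all add: annihilates proj_def) (auto simp: algebra_simps)
qed

text \<open>Orthogonal decomposition of \<open>f\<close> into eigencomponents. Both coefficients on
  the right are positive, so only functions in the eigenspace of \<open>a\<close> reach the maximal
  Rayleigh quotient.\<close>

lemma rayleigh:
  "a * ip f f - ip f (adj f) =
    (a - b) * ip (proj b a c f) (proj b a c f) + (a - c) * ip (proj c a b f) (proj c a b f)"
proof -
  let ?f0 = "proj a b c f" and ?f1 = "proj b a c f" and ?f2 = "proj c a b f"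
  note e = eigfun_proj[of f]
  have o: "ip ?f0 ?f1 = 0" "ip ?f0 ?f2 = 0" "ip ?f1 ?f2 = 0"
    using ab bc by (auto intro: eigfun_orthogonal[OF e(1) e(2)] eigfun_orthogonal[OF e(1) e(3)]
        eigfun_orthogonal[OF e(2) e(3)])
  have "adj f x = a * ?f0 x + (b * ?f1 x + c * ?f2 x)" if "x \<in> V" for x
  proof -
    have "adj f x = adj (\<lambda>x. ?f0 x + (?f1 x + ?f2 x)) x" by (simp only: proj_sum)
    then show ?thesis using e that by (simp add: eigfun_def)
  qed
  then have "ip f (adj f) =
      ip (\<lambda>x. ?f0 x + (?f1 x + ?f2 x)) (\<lambda>x. a * ?f0 x + (b * ?f1 x + c * ?f2 x))"
    by (intro ip_cong) (auto simp: proj_sum)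
  also have "\<dots> = a * ip ?f0 ?f0 + b * ip ?f1 ?f1 + c * ip ?f2 ?f2"
    by (simp add: ip_linear o ip_commute[of ?f1 ?f0] ip_commute[of ?f2 ?f0] ip_commute[of ?f2 ?f1])
  finally have 1: "ip f (adj f) = a * ip ?f0 ?f0 + b * ip ?f1 ?f1 + c * ip ?f2 ?f2" .
  have "ip f f = ip (\<lambda>x. ?f0 x + (?f1 x + ?f2 x)) (\<lambda>x. ?f0 x + (?f1 x + ?f2 x))"
    by (simp add: proj_sum)
  also have "\<dots> = ip ?f0 ?f0 + ip ?f1 ?f1 + ip ?f2 ?f2"
    by (simp add: ip_linear o ip_commute[of ?f1 ?f0] ip_commute[of ?f2 ?f0] ip_commute[of ?f2 ?f1])
  finally show ?thesis using 1 by (simp add: algebra_simps)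
qed

text \<open>Absolute values preserve the norm and do not decrease \<open>ip f (adj f)\<close>, so
  the defect in \<open>rayleigh\<close> must vanish for the absolute value too.\<close>

lemma eigfun_abs:
  assumes "eigfun a f"
  shows "eigfun a (\<lambda>x. \<bar>f x\<bar>)"
proof -
  let ?f = "\<lambda>x. \<bar>f x\<bar>"
  have "a * ip f f = ip f (adj f)"
    using assms unfolding eigfun_def ip_linear(3)[symmetric] by (intro ip_cong) auto
  also have "\<dots> \<le> ip ?f (adj ?f)"
    unfolding ip_def
  proof (rule sum_mono)
    fix x
    have "f x * adj f x \<le> \<bar>f x\<bar> * \<bar>adj f x\<bar>" by (metis abs_ge_self abs_mult)
    also have "\<dots> \<le> \<bar>f x\<bar> * adj ?f x"
      unfolding adj_def by (intro mult_left_mono sum_abs) simp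
    finally show "f x * adj f x \<le> \<bar>f x\<bar> * adj ?f x" .
  qed
  also have "ip f f = ip ?f ?f" by (simp add: ip_def)
  finally have "(a - b) * ip (proj b a c ?f) (proj b a c ?f)
      + (a - c) * ip (proj c a b ?f) (proj c a b ?f) \<le> 0"
    using rayleigh[of ?f] by simp
  moreover have "(a - b) * ip (proj b a c ?f) (proj b a c ?f) \<ge> 0"
    "(a - c) * ip (proj c a b ?f) (proj c a b ?f) \<ge> 0"
    using ab bc ip_nonneg by simp_all
  ultimately have "(a - b) * ip (proj b a c ?f) (proj b a c ?f) = 0"
    "(a - c) * ip (proj c a b ?f) (proj c a b ?f) = 0"
    by linarith+
  then have "ip (proj b a c ?f) (proj b a c ?f) = 0" "ip (proj c a b ?f) (proj c a b ?f) = 0"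
    using ab bc by auto
  then have "proj b a c ?f x = 0" "proj c a b ?f x = 0" if "x \<in> V" for x
    using that ip_self_eq_0 by blast+
  then have *: "?f x = proj a b c ?f x" if "x \<in> V" for x
    using that proj_sum[of ?f x] by simp
  then show ?thesis
    using eigfun_proj(1)[of ?f] adj_cong[OF _ *] unfolding eigfun_def by simp
qed

text \<open>At a zero of \<open>f\<close> the neighbour sum of the absolute values is 0, so the zero
  set is closed under taking neighbours.\<close>

lemma eigfun_zero:
  assumes f: "eigfun a f" and z: "z \<in> V" "f z = 0" and x: "x \<in> V"
  shows "f x = 0"
proof -
  have "{x \<in> V. f x = 0} = V"
  proof (rule connected)
    show "{x \<in> V. f x = 0} \<noteq> {}" using z by auto
    fix x assume "x \<in> {x \<in> V. f x = 0}"
    then have x: "x \<in> V" "f x = 0" by auto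
    have "adj (\<lambda>x. \<bar>f x\<bar>) x = 0" using eigfun_abs[OF f] x by (simp add: eigfun_def)
    then have "\<forall>y\<in>N x. \<bar>f y\<bar> = 0"
      unfolding adj_def using finite_N[OF x(1)] by (subst (asm) sum_nonneg_eq_0_iff) auto
    then show "N x \<subseteq> {x \<in> V. f x = 0}" using N_subset[OF x(1)] by auto
  qed auto
  then show ?thesis using x by blast
qed

text \<open>The eigenspace of \<open>a\<close> is spanned by one positive \<open>h\<close>, so the
  projection onto it has entries \<open>h x * h y / ip h h\<close>. Multiplied by
  \<open>\<kappa>\<close>, this projection is (A - b)(A - c), whose entries form the right-hand
  side.\<close>

lemma perron_vector:
  obtains \<alpha> where "\<forall>x\<in>V. \<alpha> x > 0" "eigfun a \<alpha>"
    "(\<Sum>x\<in>V. (\<alpha> x)\<^sup>2) = (a - b) * (a - c)"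
    "\<forall>x\<in>V. \<forall>y\<in>V. \<alpha> x * \<alpha> y =
      card (N x \<inter> N y) - (if y \<in> N x then b + c else 0) + (if x = y then b * c else 0)"
proof -
  obtain h0 where h0: "eigfun a h0" "\<exists>x\<in>V. h0 x \<noteq> 0" using eigfun_exists by blast
  define h where "h x = \<bar>h0 x\<bar>" for x
  have h: "eigfun a h" unfolding h_def using eigfun_abs[OF h0(1)] .
  have h_pos: "h x > 0" if "x \<in> V" for x
    using h0 eigfun_zero[OF h0(1) that] unfolding h_def by force
  obtain z where z: "z \<in> V" using h0(2) by blast
  have h_norm: "ip h h > 0" using ip_nonneg[of h] ip_self_eq_0[of h z] h_pos[OF z] z by force
  define \<kappa> where "\<kappa> = (a - b) * (a - c)"
  have \<kappa>: "\<kappa> > 0" unfolding \<kappa>_def using ab bc by simp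
  \<comment> \<open>This scaling gives \<open>s * h\<close> the squared norm
    \<open>\<kappa>\<close>, the trace of (A - b)(A - c).\<close>
  define s where "s = sqrt (\<kappa> / ip h h)"
  have s: "s > 0" "s * s = \<kappa> / ip h h" unfolding s_def using \<kappa> h_norm by auto
  have one_dim: "f x * ip h h = ip f h * h x" if f: "eigfun a f" and x: "x \<in> V" for f x
  proof -
    \<comment> \<open>With this factor \<open>f - k * h\<close> vanishes at \<open>z\<close>, hence
      everywhere by \<open>eigfun_zero\<close>.\<close>
    define k where "k = f z / h z"
    have 1: "eigfun a (\<lambda>x. f x - k * h x)"
      using f h unfolding eigfun_def by (simp add: algebra_simps)
    have 2: "f z - k * h z = 0" using h_pos[OF z] by (simp add: k_def)
    have *: "f y = k * h y" if "y \<in> V" for y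
      using eigfun_zero[OF 1 z 2 that] by simp
    then have "ip f h = k * ip h h" unfolding ip_linear(4)[symmetric] by (intro ip_cong) auto
    then show ?thesis unfolding *[OF x] by simp
  qed
  show ?thesis
  proof (rule that[of "\<lambda>x. s * h x"])
    show "\<forall>x\<in>V. s * h x > 0" using h_pos s by simp
    show "eigfun a (\<lambda>x. s * h x)" using h by (simp add: eigfun_def)
    have "(\<Sum>x\<in>V. (s * h x)\<^sup>2) = (\<Sum>x\<in>V. (s * s) * (h x * h x))"
      by (intro sum.cong refl) (simp add: power2_eq_square mult_ac)
    also have "\<dots> = (s * s) * ip h h"
      by (simp add: ip_def sum_distrib_left)
    also have "\<dots> = (a - b) * (a - c)"
      using s(2) h_norm by (simp add: \<kappa>_def)
    finally show "(\<Sum>x\<in>V. (s * h x)\<^sup>2) = (a - b) * (a - c)" .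
    show "\<forall>x\<in>V. \<forall>y\<in>V. s * h x * (s * h y) = card (N x \<inter> N y)
        - (if y \<in> N x then b + c else 0) + (if x = y then b * c else 0)"
    proof (intro ballI)
      fix x y assume x: "x \<in> V" and y: "y \<in> V"
      let ?d = "unit_fun y"
      let ?p = "proj a b c ?d"
      have "ip ?d h = (\<Sum>x\<in>V. if x = y then h x else 0)"
        unfolding ip_def unit_fun_def by (intro sum.cong) auto
      then have "ip ?d h = h y" using y finite_V by simp
      moreover have "ip ?d h = ip (\<lambda>x. ?p x + (proj b a c ?d x + proj c a b ?d x)) h"
        by (simp add: proj_sum)
      \<comment> \<open>Only the component of the unit function for \<open>a\<close> contributes to
        its inner product with \<open>h\<close>.\<close>
      moreover have "ip (proj b a c ?d) h = 0" "ip (proj c a b ?d) h = 0"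
        using eigfun_orthogonal[OF eigfun_proj(2) h] eigfun_orthogonal[OF eigfun_proj(3) h] ab bc
        by simp_all
      ultimately have "ip ?p h = h y" by (simp add: ip_linear)
      then have "\<kappa> * ?p x * ip h h = \<kappa> * (h y * h x)"
        using one_dim[OF eigfun_proj(1) x, of ?d] by simp
      then have "\<kappa> * (h y * h x) / ip h h = \<kappa> * ?p x"
        using h_norm by (metis less_irrefl nonzero_mult_div_cancel_right)
      moreover have "s * h x * (s * h y) = (s * s) * (h y * h x)" by (simp add: mult_ac)
      ultimately have "s * h x * (s * h y) = \<kappa> * ?p x"
        unfolding s(2) by simp
      also have "\<kappa> * ?p x = adj (adj ?d) x - (b + c) * adj ?d x + b * c * ?d x"
        using \<kappa> unfolding proj_def \<kappa>_def[symmetric] by simp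
      finally show "s * h x * (s * h y) =
          card (N x \<inter> N y) - (if y \<in> N x then b + c else 0) + (if x = y then b * c else 0)"
        using x y by (auto simp: adj_adj_unit_fun adj_unit_fun unit_fun_def)
    qed
  qed
qed

end

section \<open>From the adjacency matrix to the adjacency operator\<close>

context neighbourhood_graph
begin

definition nbh_mat :: "'a list \<Rightarrow> real mat" where
  "nbh_mat vs = mat (length vs) (length vs) (\<lambda>(i, j). if vs ! j \<in> N (vs ! i) then 1 else 0)"

definition fun_vec :: "'a list \<Rightarrow> ('a \<Rightarrow> real) \<Rightarrow> real vec" where
  "fun_vec vs f = vec (length vs) (\<lambda>i. f (vs ! i))"

lemma nbh_mat_carrier: "nbh_mat vs \<in> carrier_mat (length vs) (length vs)"
  by (simp add: nbh_mat_def)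

lemma fun_vec_carrier: "fun_vec vs f \<in> carrier_vec (length vs)"
  by (simp add: fun_vec_def)

lemma nbh_mat_mult_fun_vec:
  assumes vs: "distinct vs" "set vs = V"
  shows "nbh_mat vs *\<^sub>v fun_vec vs f = fun_vec vs (adj f)"
proof (rule eq_vecI)
  fix i assume "i < dim_vec (fun_vec vs (adj f))"
  then have i: "i < length vs" by (simp add: fun_vec_def)
  then have x: "vs ! i \<in> V" using vs by auto
  let ?g = "\<lambda>y. if y \<in> N (vs ! i) then f y else 0"
  have "(nbh_mat vs *\<^sub>v fun_vec vs f) $ i = (\<Sum>j<length vs. ?g (vs ! j))"
    using i by (auto simp: nbh_mat_def fun_vec_def scalar_prod_def lessThan_atLeast0 intro!: sum.cong)
  also have "\<dots> = (\<Sum>y\<in>V. ?g y)"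
    by (rule sum.reindex_bij_betw[OF bij_betw_nth[OF vs(1) refl vs(2)[symmetric]]])
  also have "\<dots> = sum f (V \<inter> N (vs ! i))" using finite_V by (simp add: sum.inter_restrict)
  also have "V \<inter> N (vs ! i) = N (vs ! i)" using N_subset[OF x] by blast
  finally show "(nbh_mat vs *\<^sub>v fun_vec vs f) $ i = fun_vec vs (adj f) $ i"
    using i by (simp add: fun_vec_def adj_def)
qed (simp add: nbh_mat_def fun_vec_def)

lemma three_eigenvalue_nbhI:
  assumes "a > b" "b > c"
    and "\<And>S. S \<subseteq> V \<Longrightarrow> S \<noteq> {} \<Longrightarrow> (\<And>x. x \<in> S \<Longrightarrow> N x \<subseteq> S) \<Longrightarrow> S = V"
    and vs: "distinct vs" "set vs = V" and spec: "spectrum (nbh_mat vs) = {a, b, c}"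
  shows "three_eigenvalue_nbh V N a b c"
proof unfold_locales
  let ?n = "length vs" and ?A = "nbh_mat vs"
  note A = nbh_mat_carrier[of vs]
  note mult = nbh_mat_mult_fun_vec[OF vs]
  have shift: "(?A - k \<cdot>\<^sub>m 1\<^sub>m ?n) *\<^sub>v fun_vec vs f = fun_vec vs (\<lambda>x. adj f x - k * f x)" for k f
  proof -
    have "(?A - k \<cdot>\<^sub>m 1\<^sub>m ?n) *\<^sub>v fun_vec vs f =
        ?A *\<^sub>v fun_vec vs f - (k \<cdot>\<^sub>m 1\<^sub>m ?n) *\<^sub>v fun_vec vs f"
      using A fun_vec_carrier by (intro minus_mult_distrib_mat_vec) auto
    also have "(k \<cdot>\<^sub>m 1\<^sub>m ?n) *\<^sub>v fun_vec vs f = k \<cdot>\<^sub>v fun_vec vs f"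
      using fun_vec_carrier[of vs f] by (intro eq_vecI) auto
    finally show ?thesis unfolding mult by (auto simp: fun_vec_def)
  qed
  have sym: "?A $$ (i, j) = ?A $$ (j, i)" if "i < ?n" "j < ?n" for i j
    using that vs N_sym[of "vs ! i" "vs ! j"] by (auto simp: nbh_mat_def)
  let ?s = "\<lambda>k. ?A - k \<cdot>\<^sub>m 1\<^sub>m ?n"
  have s: "?s k \<in> carrier_mat ?n ?n" for k by (intro minus_carrier_mat) simp
  have zero: "?s a * ?s b * ?s c = 0\<^sub>m ?n ?n"
    by (rule symmetric_three_eigenvalues_annihilates[OF A sym]) (use spec in auto)
  fix f x assume x: "x \<in> V"
  let ?d = "\<lambda>k f x. adj f x - k * f x"
  have "fun_vec vs (?d a (?d b (?d c f))) = ?s a *\<^sub>v (?s b *\<^sub>v (?s c *\<^sub>v fun_vec vs f))"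
    by (simp only: shift)
  also have "\<dots> = (?s a * ?s b * ?s c) *\<^sub>v fun_vec vs f"
    using s fun_vec_carrier
    by (simp only: assoc_mult_mat_vec[of _ ?n ?n _ ?n] mult_carrier_mat[of _ ?n ?n _ ?n] mult_mat_vec_carrier[of _ ?n ?n])
  also have "\<dots> = 0\<^sub>v ?n" unfolding zero using fun_vec_carrier[of vs f] by (intro eq_vecI) auto
  finally have zero_vec: "fun_vec vs (?d a (?d b (?d c f))) = 0\<^sub>v ?n" .
  obtain i where i: "i < ?n" "x = vs ! i" using x vs by (metis in_set_conv_nth)
  have "fun_vec vs (?d a (?d b (?d c f))) $ i = 0" unfolding zero_vec using i by simp
  then have "?d a (?d b (?d c f)) x = 0"
    unfolding fun_vec_def index_vec[OF i(1)] i(2)[symmetric] .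
  then show "adj (adj (adj f)) x = (a + b + c) * adj (adj f) x
      - (a * b + a * c + b * c) * adj f x + a * b * c * f x"
    by (simp add: algebra_simps)
next
  let ?n = "length vs" and ?A = "nbh_mat vs"
  note mult = nbh_mat_mult_fun_vec[OF vs]
  have "a \<in> spectrum ?A" using spec by simp
  then obtain v where v: "v \<in> carrier_vec ?n" "v \<noteq> 0\<^sub>v ?n" "?A *\<^sub>v v = a \<cdot>\<^sub>v v"
    using nbh_mat_carrier[of vs] unfolding spectrum_def eigenvalue_def eigenvector_def by auto
  \<comment> \<open>The eigenvector read as a function on the vertices through the inverse of the
    enumeration; values outside \<open>V\<close> are arbitrary.\<close>
  define h where "h x = v $ (inv_into {..<?n} ((!) vs) x)" for x
  have h: "h (vs ! i) = v $ i" if "i < ?n" for i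
    unfolding h_def using that inv_into_f_f[OF inj_on_nth[OF vs(1)], of "{..<?n}" i] by simp
  have hv: "fun_vec vs h = v" using v(1) by (auto simp: fun_vec_def h)
  have adj_h: "fun_vec vs (adj h) = a \<cdot>\<^sub>v v" using mult[of h] v(3) unfolding hv by simp
  have ev: "adj h (vs ! i) = a * h (vs ! i)" if "i < ?n" for i
    using arg_cong[OF adj_h, of "\<lambda>w. w $ i"] that v(1) h[OF that] by (simp add: fun_vec_def)
  have "eigfun a h" unfolding eigfun_def using ev vs by (metis in_set_conv_nth)
  moreover obtain i where "i < ?n" "v $ i \<noteq> 0"
    using v(1,2) by (metis carrier_vecD eq_vecI index_zero_vec(1) index_zero_vec(2))
  then have "\<exists>x\<in>V. h x \<noteq> 0" using h vs by (metis nth_mem)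
  ultimately show "\<exists>h. eigfun a h \<and> (\<exists>x\<in>V. h x \<noteq> 0)" by blast
qed (use assms in auto)

end

section \<open>Integrality\<close>

text \<open>Rational root theorem: clearing denominators makes \<open>q\<close> divide
  \<open>p\<^sup>2\<close>, and coprimality leaves \<open>q = 1\<close>.\<close>

lemma rat_root_of_monic_quadratic:
  fixes x :: real
  assumes "x \<in> \<rat>" "B \<in> \<int>" "C \<in> \<int>" "x\<^sup>2 + B * x + C = 0"
  shows "x \<in> \<int>"
proof -
  obtain p q where pq: "q > 0" "coprime p q" "x = of_int p / of_int q"
    using Rats_cases'[OF assms(1)] by metis
  obtain B' C' where BC: "B = of_int B'" "C = of_int C'"
    using assms(2,3) by (auto elim!: Ints_cases)
  have "(real_of_int p)\<^sup>2 + B * p * q + C * q\<^sup>2 = (x\<^sup>2 + B * x + C) * q\<^sup>2"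
    using pq by (simp add: field_simps power2_eq_square)
  also have "\<dots> = 0" using assms(4) by simp
  finally have "real_of_int (p\<^sup>2 + B' * p * q + C' * q\<^sup>2) = of_int 0"
    unfolding BC by simp
  then have "p\<^sup>2 + B' * p * q + C' * q\<^sup>2 = 0" by (simp only: of_int_eq_iff)
  then have "p\<^sup>2 = q * (- B' * p - C' * q)" by (simp add: algebra_simps power2_eq_square)
  then have "q dvd p\<^sup>2" by simp
  moreover have "coprime (p\<^sup>2) q" using pq(2) by simp
  ultimately have "is_unit q" by (metis coprime_absorb_right)
  then have "q = 1" using pq(1) by simp
  then show ?thesis using pq(3) by simp
qed

lemma rat_square_ne_2:
  fixes x :: real
  assumes "x \<in> \<rat>"
  shows "x\<^sup>2 \<noteq> 2"
proof
  assume "x\<^sup>2 = 2"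
  then have "x \<in> \<int>" using rat_root_of_monic_quadratic[of x 0 "-2"] assms by simp
  then obtain k where "x = of_int k" by (auto elim: Ints_cases)
  with \<open>x\<^sup>2 = 2\<close> have "real_of_int (k\<^sup>2) = of_int 2" by simp
  then have k: "k\<^sup>2 = 2" by (simp only: of_int_eq_iff)
  then have "\<bar>k\<bar> < 2" using abs_square_less_1 power2_less_imp_less[of "\<bar>k\<bar>" 2] by simp
  then have "k = -1 \<or> k = 0 \<or> k = 1" by linarith
  then show False using k by auto
qed

text \<open>Linear independence of 1 and \<open>a\<close> over the rationals, used for comparing
  coefficients.\<close>

lemma irrational_linear:
  fixes a :: real
  assumes "a \<notin> \<rat>" "p \<in> \<rat>" "q \<in> \<rat>" "p + q * a = 0"
  shows "q = 0" "p = 0"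
proof -
  show "q = 0"
  proof (rule ccontr)
    assume "q \<noteq> 0"
    then have "a = - p / q" using assms(4) by (simp add: field_simps)
    then show False using assms by simp
  qed
  then show "p = 0" using assms(4) by simp
qed

text \<open>\<open>gram\<close> is the matrix identity for (A - b)(A - c) read entry by entry, and
  \<open>square_sum\<close> is its trace.\<close>

locale rank_one_graph = neighbourhood_graph +
  fixes a b c :: real and \<alpha> :: "'a \<Rightarrow> real"
  assumes ab: "a > b" and bc: "b > c"
    and connected: "\<And>S. S \<subseteq> V \<Longrightarrow> S \<noteq> {} \<Longrightarrow> (\<And>x. x \<in> S \<Longrightarrow> N x \<subseteq> S) \<Longrightarrow> S = V"
    and not_regular: "\<exists>x\<in>V. \<exists>y\<in>V. card (N x) \<noteq> card (N y)"
    and not_bipartite: "\<And>X Y. X \<union> Y = V \<Longrightarrow> X \<inter> Y = {} \<Longrightarrow> (\<And>x. x \<in> X \<Longrightarrow> N x \<subseteq> Y) \<Longrightarrow>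
      (\<And>y. y \<in> Y \<Longrightarrow> N y \<subseteq> X) \<Longrightarrow> False"
    and pos: "x \<in> V \<Longrightarrow> \<alpha> x > 0"
    and eigenvector: "x \<in> V \<Longrightarrow> (\<Sum>y\<in>N x. \<alpha> y) = a * \<alpha> x"
    and square_sum: "(\<Sum>x\<in>V. (\<alpha> x)\<^sup>2) = (a - b) * (a - c)"
    and gram: "x \<in> V \<Longrightarrow> y \<in> V \<Longrightarrow> \<alpha> x * \<alpha> y =
      card (N x \<inter> N y) - (if y \<in> N x then b + c else 0) + (if x = y then b * c else 0)"
begin

lemma N_in_V: "x \<in> V \<Longrightarrow> y \<in> N x \<Longrightarrow> y \<in> V"
  using N_subset by blast

lemma degree_eq: "x \<in> V \<Longrightarrow> (\<alpha> x)\<^sup>2 = card (N x) + b * c"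
  using gram[of x x] N_irrefl by (simp add: power2_eq_square)

lemma nonadjacent_eq:
  "x \<in> V \<Longrightarrow> y \<in> V \<Longrightarrow> x \<noteq> y \<Longrightarrow> y \<notin> N x \<Longrightarrow> \<alpha> x * \<alpha> y = card (N x \<inter> N y)"
  using gram[of x y] by simp

lemma adjacent_eq:
  assumes "x \<in> V" "y \<in> N x"
  shows "\<alpha> x * \<alpha> y = card (N x \<inter> N y) - (b + c)"
  using gram[of x y] N_in_V[OF assms] assms N_irrefl[of x] by auto

text \<open>For nonadjacent vertices the positive product of the entries of \<open>\<alpha>\<close>
  counts the common neighbours.\<close>

lemma common_neighbour:
  assumes "x \<in> V" "y \<in> V" "x \<noteq> y" "y \<notin> N x"
  obtains z where "z \<in> N x" "z \<in> N y"
proof -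
  have "real (card (N x \<inter> N y)) > 0"
    using nonadjacent_eq[OF assms] pos assms by (metis mult_pos_pos)
  then have "N x \<inter> N y \<noteq> {}" by auto
  then show ?thesis using that by blast
qed

text \<open>Without a nonadjacent pair the graph is complete, hence regular.\<close>

lemma ex_induced_path:
  obtains x y z where "x \<in> V" "y \<in> V" "z \<in> V" "x \<noteq> z" "z \<notin> N x" "y \<in> N x" "y \<in> N z"
proof -
  have "\<exists>x\<in>V. \<exists>z\<in>V. x \<noteq> z \<and> z \<notin> N x"
  proof (rule ccontr)
    assume "\<not> ?thesis"
    then have *: "z \<in> N x" if "x \<in> V" "z \<in> V" "x \<noteq> z" for x z using that by metis
    have "card (N x) = card V - 1" if x: "x \<in> V" for x
    proof -
      have "N x = V - {x}" using *[OF x] N_subset[OF x] N_irrefl[OF x] by auto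
      then show ?thesis using x finite_V by simp
    qed
    then show False using not_regular by auto
  qed
  then obtain x z where xz: "x \<in> V" "z \<in> V" "x \<noteq> z" "z \<notin> N x" by blast
  then obtain y where "y \<in> N x" "y \<in> N z" by (rule common_neighbour)
  then show ?thesis using that[of x y z] xz N_in_V[of x y] by blast
qed

text \<open>One more application of A to the rank-one matrix multiplies it by \<open>a\<close>; the
  right-hand side is an entry of A(A - b)(A - c).\<close>

lemma three_walks:
  assumes x: "x \<in> V" and y: "y \<in> V"
  shows "a * (\<alpha> x * \<alpha> y) = real (\<Sum>z\<in>N x. card (N z \<inter> N y)) - (b + c) * card (N x \<inter> N y)
    + (if y \<in> N x then b * c else 0)"
proof -
  have "a * (\<alpha> x * \<alpha> y) = (\<Sum>z\<in>N x. \<alpha> z * \<alpha> y)"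
    using eigenvector[OF x] by (simp add: sum_distrib_right[symmetric])
  also have "\<dots> = (\<Sum>z\<in>N x. real (card (N z \<inter> N y)) - (if z \<in> N y then b + c else 0)
      + (if z = y then b * c else 0))"
  proof (intro sum.cong refl)
    fix z assume "z \<in> N x"
    then have "z \<in> V" using N_in_V x by blast
    then show "\<alpha> z * \<alpha> y = real (card (N z \<inter> N y)) - (if z \<in> N y then b + c else 0)
      + (if z = y then b * c else 0)"
      using gram[OF _ y] N_sym[OF y] by simp
  qed
  also have "\<dots> = real (\<Sum>z\<in>N x. card (N z \<inter> N y)) - (\<Sum>z\<in>N x. if z \<in> N y then b + c else 0)
      + (\<Sum>z\<in>N x. if z = y then b * c else 0)"
    by (simp add: sum.distrib sum_subtractf)
  also have "(\<Sum>z\<in>N x. if z \<in> N y then b + c else 0) = (b + c) * card (N x \<inter> N y)"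
    using finite_N[OF x] by (simp add: sum.If_cases Int_def mult.commute)
  also have "(\<Sum>z\<in>N x. if z = y then b * c else 0) = (if y \<in> N x then b * c else 0)"
    using finite_N[OF x] by simp
  finally show ?thesis .
qed

text \<open>On an induced path, \<open>three_walks\<close> for a nonadjacent, an adjacent and an
  equal pair determines the three symmetric functions in turn from walk counts.\<close>

lemma elementary_symmetric_rational:
  "a + b + c \<in> \<rat>" "a * (b + c) + b * c \<in> \<rat>" "a * (b * c) \<in> \<rat>"
proof -
  obtain x y z where p: "x \<in> V" "y \<in> V" "z \<in> V" "x \<noteq> z" "z \<notin> N x" "y \<in> N x" "y \<in> N z"
    by (rule ex_induced_path)
  define W where "W u v = real (\<Sum>w\<in>N u. card (N w \<inter> N v))" for u v
  have W: "W u v \<in> \<rat>" for u v unfolding W_def by (rule Rats_of_nat)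
  define \<mu> where "\<mu> = real (card (N x \<inter> N z))"
  have \<mu>: "\<mu> = \<alpha> x * \<alpha> z" unfolding \<mu>_def using nonadjacent_eq[of x z] p by simp
  have \<mu>_pos: "\<mu> > 0" unfolding \<mu> using p pos by simp
  have "a * \<mu> = W x z - (b + c) * \<mu>"
    using three_walks[of x z] p unfolding \<mu>[symmetric] W_def[symmetric] \<mu>_def[symmetric] by simp
  then have "a + b + c = W x z / \<mu>" using \<mu>_pos by (simp add: field_simps)
  then show s: "a + b + c \<in> \<rat>" using W by (simp add: \<mu>_def)
  have "a * (card (N x \<inter> N y) - (b + c)) = W x y - (b + c) * card (N x \<inter> N y) + b * c"
    using three_walks[of x y] p unfolding adjacent_eq[OF p(1,6)] W_def by simp
  then have "a * (b + c) + b * c = (a + b + c) * card (N x \<inter> N y) - W x y"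
    by (simp add: algebra_simps)
  then show "a * (b + c) + b * c \<in> \<rat>" using s W by simp
  have "a * (card (N x) + b * c) = W x x - (b + c) * card (N x)"
    using three_walks[of x x] p N_irrefl[OF p(1)] degree_eq[OF p(1)]
    unfolding W_def power2_eq_square by simp
  then have "a * (b * c) = W x x - (a + b + c) * card (N x)"
    by (simp add: algebra_simps)
  then show "a * (b * c) \<in> \<rat>" using s W by simp
qed

text \<open>An induced path would be the whole graph, which is then bipartite. This permits the
  division by \<open>n - 3\<close> in \<open>rational_quadratic\<close>.\<close>

lemma card_V_ne_3: "card V \<noteq> 3"
proof
  assume n: "card V = 3"
  obtain x y z where p: "x \<in> V" "y \<in> V" "z \<in> V" "x \<noteq> z" "z \<notin> N x" "y \<in> N x" "y \<in> N z"
    by (rule ex_induced_path)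
  have d: "y \<noteq> x" "y \<noteq> z" using p N_irrefl by blast+
  have "card {x, y, z} = 3" using p d by simp
  then have V: "V = {x, y, z}" using p n finite_V card_subset_eq[of V "{x, y, z}"] by simp
  have s: "N x \<subseteq> V" "N y \<subseteq> V" "N z \<subseteq> V" using N_subset p by auto
  have "N x \<subseteq> {y}" "N z \<subseteq> {y}" "N y \<subseteq> {x, z}"
    using s p N_irrefl N_sym[of x z] unfolding V by auto
  then show False using not_bipartite[of "{x, z}" "{y}"] V d p by auto
qed

text \<open>The trace of the rank-one matrix is a second, rational quadratic, equation for \<open>a\<close>.\<close>

lemma rational_quadratic:
  obtains u v where "u \<in> \<rat>" "v \<in> \<rat>" "a\<^sup>2 = u * a + v"
proof -
  define s e D n where defs: "s = a + b + c" "e = a * (b + c) + b * c"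
    "D = (\<Sum>x\<in>V. real (card (N x)))" "n = real (card V)"
  have "(a - b) * (a - c) = (\<Sum>x\<in>V. card (N x) + b * c)"
    unfolding square_sum[symmetric] by (intro sum.cong refl) (simp add: degree_eq)
  also have "\<dots> = D + n * (b * c)" by (simp add: defs sum.distrib)
  \<comment> \<open>Substituting \<open>b + c = s - a\<close> and
    \<open>b * c = e - a * (s - a)\<close> leaves only \<open>a\<close> and rational
    coefficients.\<close>
  finally have "(n - 3) * a\<^sup>2 = (n - 2) * s * a + (e - n * e - D)"
    unfolding defs(1,2) by Groebner_Basis.algebra
  moreover have "n - 3 \<noteq> 0" using card_V_ne_3 unfolding defs by linarith
  ultimately have "a\<^sup>2 = ((n - 2) * s * a + (e - n * e - D)) / (n - 3)"
    by (metis nonzero_mult_div_cancel_left)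
  then have "a\<^sup>2 = (n - 2) * s / (n - 3) * a + (e - n * e - D) / (n - 3)"
    by (simp add: add_divide_distrib)
  moreover have "(n - 2) * s / (n - 3) \<in> \<rat>" "(e - n * e - D) / (n - 3) \<in> \<rat>"
  proof -
    have "s \<in> \<rat>" "e \<in> \<rat>" using elementary_symmetric_rational(1,2) by (simp_all add: defs)
    moreover have "D \<in> \<rat>" "n \<in> \<rat>" unfolding defs by (simp_all only: of_nat_sum[symmetric] Rats_of_nat)
    ultimately show "(n - 2) * s / (n - 3) \<in> \<rat>" "(e - n * e - D) / (n - 3) \<in> \<rat>" by simp_all
  qed
  ultimately show ?thesis using that by blast
qed

text \<open>
  If \<open>a\<close> is irrational, then its conjugate \<open>u - a\<close> is one of \<open>b\<close>, \<open>c\<close>, and \<open>\<theta>\<close> is the other one.  Comparing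
  coefficients of \<open>a\<close> along an induced path gives \<open>\<theta> \<in> {0, - sqrt 2, sqrt 2}\<close>; and if \<open>\<theta> = 0\<close>, then two vertices are
  adjacent exactly if \<open>\<alpha> x * \<alpha> y\<close> is irrational, which makes the graph bipartite.
\<close>

lemma irrational_case:
  assumes irr: "a \<notin> \<rat>" and rat: "u \<in> \<rat>" "v \<in> \<rat>" "\<theta> \<in> \<rat>" and quad: "a\<^sup>2 = u * a + v"
    and t: "b + c = u - a + \<theta>" and m: "b * c = (u - a) * \<theta>"
  shows False
proof -
  note lin = irrational_linear[OF irr]
  define e where "e x = card (N x) + u * \<theta>" for x
  define l where "l x y = card (N x \<inter> N y) - u - \<theta>" for x y
  have sq: "\<alpha> x * \<alpha> x = e x - \<theta> * a" if "x \<in> V" for x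
    using degree_eq[OF that] unfolding m e_def by (simp add: power2_eq_square algebra_simps)
  have edge: "\<alpha> x * \<alpha> y = l x y + a" if "x \<in> V" "y \<in> N x" for x y
    using adjacent_eq[OF that] unfolding t l_def by simp
  have rats: "e x \<in> \<rat>" "l x y \<in> \<rat>" for x y using rat by (simp_all add: e_def l_def)
  have \<theta>: "\<theta> = 0"
  proof (rule ccontr)
    assume \<theta>: "\<theta> \<noteq> 0"
    obtain x y z where p: "x \<in> V" "y \<in> V" "z \<in> V" "x \<noteq> z" "z \<notin> N x" "y \<in> N x" "y \<in> N z"
      by (rule ex_induced_path)
    define \<mu> where "\<mu> = real (card (N x \<inter> N z))"
    have \<mu>: "\<alpha> x * \<alpha> z = \<mu>" unfolding \<mu>_def using nonadjacent_eq[of x z] p by simp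
    have \<mu>_pos: "\<mu> \<noteq> 0" unfolding \<mu>[symmetric] using p pos[of x] pos[of z] by simp
    have \<mu>_rat: "\<mu> \<in> \<rat>" by (simp add: \<mu>_def)
    note E = edge[OF p(1,6)] edge[OF p(3,7)] sq[OF p(1)] sq[OF p(2)] sq[OF p(3)]
    \<comment> \<open>Four relations between the products of entries of \<open>\<alpha>\<close> on
      the path. After reduction by \<open>quad\<close>, the coefficient of \<open>a\<close> vanishes
      in each.\<close>
    have "(l x y + a) * (l z y + a) = (e y - \<theta> * a) * \<mu>"
      unfolding E[symmetric] \<mu>[symmetric] by simp
    then have "(l x y * l z y + v - e y * \<mu>) + (l x y + l z y + u + \<theta> * \<mu>) * a = 0"
      using quad by Groebner_Basis.algebra
    then have 1: "l x y + l z y + u + \<theta> * \<mu> = 0"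
      by (rule lin(1)[rotated 2]) (simp_all add: rats rat \<mu>_rat)
    have "\<mu> * (l x y + a) = (e x - \<theta> * a) * (l z y + a)"
      unfolding E[symmetric] \<mu>[symmetric] by simp
    then have "(\<mu> * l x y - e x * l z y + \<theta> * v) + (\<mu> - e x + \<theta> * l z y + \<theta> * u) * a = 0"
      using quad by Groebner_Basis.algebra
    then have 2: "\<mu> - e x + \<theta> * l z y + \<theta> * u = 0"
      by (rule lin(1)[rotated 2]) (simp_all add: rats rat \<mu>_rat)
    have "\<mu> * (l z y + a) = (e z - \<theta> * a) * (l x y + a)"
      unfolding E[symmetric] \<mu>[symmetric] by simp
    then have "(\<mu> * l z y - e z * l x y + \<theta> * v) + (\<mu> - e z + \<theta> * l x y + \<theta> * u) * a = 0"
      using quad by Groebner_Basis.algebra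
    then have 3: "\<mu> - e z + \<theta> * l x y + \<theta> * u = 0"
      by (rule lin(1)[rotated 2]) (simp_all add: rats rat \<mu>_rat)
    have "(e x - \<theta> * a) * (e z - \<theta> * a) = \<mu> * \<mu>"
      unfolding E[symmetric] \<mu>[symmetric] by simp
    then have "(e x * e z - \<mu> * \<mu> + \<theta> * \<theta> * v) + \<theta> * (\<theta> * u - e x - e z) * a = 0"
      using quad by Groebner_Basis.algebra
    then have "\<theta> * (\<theta> * u - e x - e z) = 0"
      by (rule lin(1)[rotated 2]) (simp_all add: rats rat \<mu>_rat)
    then have 4: "\<theta> * u - e x - e z = 0" using \<theta> by simp
    \<comment> \<open>Add 2 and 3, then insert the sum of the \<open>l\<close> terms from 1 and that
      of the \<open>e\<close> terms from 4.\<close>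
    have "(\<theta>\<^sup>2 - 2) * \<mu> = 0" using 1 2 3 4 by Groebner_Basis.algebra
    then have "\<theta>\<^sup>2 = 2" using \<mu>_pos by simp
    then show False using rat_square_ne_2[OF rat(3)] by simp
  qed
  have sq0: "\<alpha> x * \<alpha> x \<in> \<rat>" if "x \<in> V" for x using sq[OF that] rats \<theta> by simp
  have edge0: "\<alpha> x * \<alpha> y = a - u / 2" if x: "x \<in> V" "y \<in> N x" for x y
  proof -
    have y: "y \<in> V" using N_in_V x by blast
    \<comment> \<open>The square of an edge product is rational, which fixes its rational part at
      \<open>- u / 2\<close>, the same for every edge.\<close>
    have "(l x y + a) * (l x y + a) = e x * e y"
      using sq[OF x(1)] sq[OF y] unfolding edge[OF x, symmetric] \<theta> by Groebner_Basis.algebra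
    then have "(l x y * l x y + v - e x * e y) + (2 * l x y + u) * a = 0"
      using quad by Groebner_Basis.algebra
    then have "2 * l x y + u = 0"
      using lin(1)[of "l x y * l x y + v - e x * e y" "2 * l x y + u"] rats rat by simp
    then show ?thesis using edge[OF x] by simp
  qed
  have nonrat: "a - u / 2 \<notin> \<rat>"
  proof
    assume "a - u / 2 \<in> \<rat>"
    then have "(a - u / 2) + u / 2 \<in> \<rat>" using rat(1) by (intro Rats_add) simp_all
    then show False using irr by simp
  qed
  have nonedge: "\<alpha> x * \<alpha> y \<in> \<rat>" if "x \<in> V" "y \<in> V" "y \<notin> N x" for x y
    using that sq0 nonadjacent_eq[of x y] by (cases "x = y") simp_all
  obtain x0 where x0: "x0 \<in> V" using not_regular by blast
  have pos0: "\<alpha> x0 \<noteq> 0" using pos[OF x0] by simp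
  show False
  proof (rule not_bipartite[of "N x0" "V - N x0"])
    show "N x0 \<union> (V - N x0) = V" using N_subset[OF x0] by blast
    fix z assume z: "z \<in> N x0"
    have zV: "z \<in> V" using z N_in_V x0 by blast
    have False if w: "w \<in> N z" "w \<in> N x0" for w
    proof -
      \<comment> \<open>In a triangle the three equal edge products would make the square of
        \<open>\<alpha> x0\<close> irrational.\<close>
      have "(a - u / 2) * (\<alpha> x0 * \<alpha> x0) = (a - u / 2) * (a - u / 2)"
        using edge0[OF zV w(1)] edge0[OF x0 z] edge0[OF x0 w(2)] by Groebner_Basis.algebra
      moreover have "a - u / 2 \<noteq> 0" using nonrat by (metis Rats_0)
      ultimately have "\<alpha> x0 * \<alpha> x0 = a - u / 2" by simp
      then show False using sq0[OF x0] nonrat by simp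
    qed
    then show "N z \<subseteq> V - N x0" using N_subset[OF zV] by blast
  next
    fix z assume z: "z \<in> V - N x0"
    have False if w: "w \<in> N z" "w \<notin> N x0" for w
    proof -
      have wV: "w \<in> V" using w z N_in_V by blast
      have "(a - u / 2) * (\<alpha> x0 * \<alpha> x0) = (\<alpha> x0 * \<alpha> z) * (\<alpha> x0 * \<alpha> w)"
        using edge0[of z w] w z by Groebner_Basis.algebra
      moreover have "\<alpha> x0 * \<alpha> x0 \<noteq> 0" using pos0 by simp
      ultimately have "a - u / 2 = (\<alpha> x0 * \<alpha> z) * (\<alpha> x0 * \<alpha> w) / (\<alpha> x0 * \<alpha> x0)"
        by (metis nonzero_mult_div_cancel_right)
      also have "\<dots> \<in> \<rat>"
        using nonedge[OF x0 wV w(2)] nonedge[OF x0, of z] z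
        by (intro Rats_divide[OF Rats_mult] sq0[OF x0]) simp_all
      finally show False using nonrat by blast
    qed
    then show "N z \<subseteq> N x0" by blast
  qed auto
qed

text \<open>Reducing the cubic with roots \<open>a\<close>, \<open>b\<close>, \<open>c\<close>
  modulo the quadratic of an irrational \<open>a\<close> leaves a remainder with rational
  coefficients, which must be 0. So the conjugate \<open>u - a\<close>, which differs from
  \<open>a\<close>, is \<open>b\<close> or \<open>c\<close>.\<close>

lemma a_rational: "a \<in> \<rat>"
proof (rule ccontr)
  assume irr: "a \<notin> \<rat>"
  obtain u v where uv: "u \<in> \<rat>" "v \<in> \<rat>" "a\<^sup>2 = u * a + v" by (rule rational_quadratic)
  define s e g where defs: "s = a + b + c" "e = a * (b + c) + b * c" "g = a * (b * c)"
  have rat: "s \<in> \<rat>" "e \<in> \<rat>" "g \<in> \<rat>" using elementary_symmetric_rational by (simp_all add: defs)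
  have "(u * v - s * v - g) + (u\<^sup>2 + v - s * u + e) * a = 0"
    using uv(3) unfolding defs by Groebner_Basis.algebra
  then have *: "u\<^sup>2 + v - s * u + e = 0" "u * v - s * v - g = 0"
    using irrational_linear[OF irr, of "u * v - s * v - g" "u\<^sup>2 + v - s * u + e"] rat uv(1,2) by simp_all
  have "(u - a - a) * ((u - a - b) * (u - a - c)) = 0"
    using * uv(3) unfolding defs by Groebner_Basis.algebra
  moreover have "u - a - a \<noteq> 0"
  proof
    assume "u - a - a = 0"
    then have "a = u / 2" by simp
    moreover have "u / 2 \<in> \<rat>" using uv(1) by simp
    ultimately show False using irr by metis
  qed
  ultimately have "b = u - a \<or> c = u - a" by auto
  then show False
  proof
    assume b: "b = u - a"
    then have "c = s - u" by (simp add: defs)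
    then have "c \<in> \<rat>" using rat uv by simp
    then show False using irrational_case[OF irr uv(1,2) _ uv(3), of c] b by simp
  next
    assume c: "c = u - a"
    then have "b = s - u" by (simp add: defs)
    then have "b \<in> \<rat>" using rat uv by simp
    then show False using irrational_case[OF irr uv(1,2) _ uv(3), of b] c by simp
  qed
qed

text \<open>A nonadjacent pair gives a monic integral quadratic for the rational number
  \<open>b * c\<close>. For an adjacent pair, \<open>\<alpha> x * \<alpha> y\<close> is then
  rational with integral square, hence integral.\<close>

lemma mult_integer: "b * c \<in> \<int>" and add_integer: "b + c \<in> \<int>"
proof -
  obtain x y z where p: "x \<in> V" "y \<in> V" "z \<in> V" "x \<noteq> z" "z \<notin> N x" "y \<in> N x" "y \<in> N z"
    by (rule ex_induced_path)
  have "(a + b + c) - a \<in> \<rat>"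
    using elementary_symmetric_rational(1) a_rational by (rule Rats_diff)
  then have t: "b + c \<in> \<rat>" by simp
  have "(a * (b + c) + b * c) - a * (b + c) \<in> \<rat>"
    using elementary_symmetric_rational(2) a_rational t by (intro Rats_diff Rats_mult)
  then have m: "b * c \<in> \<rat>" by simp
  have "(\<alpha> x)\<^sup>2 * (\<alpha> z)\<^sup>2 = (\<alpha> x * \<alpha> z)\<^sup>2" by (simp add: power_mult_distrib)
  then have "(card (N x) + b * c) * (card (N z) + b * c) = (real (card (N x \<inter> N z)))\<^sup>2"
    using nonadjacent_eq[of x z] p by (simp add: degree_eq)
  then have "(b * c)\<^sup>2 + (real (card (N x)) + real (card (N z))) * (b * c) +
      (real (card (N x)) * real (card (N z)) - (real (card (N x \<inter> N z)))\<^sup>2) = 0"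
    by (simp add: algebra_simps power2_eq_square)
  then show mi: "b * c \<in> \<int>"
    by (rule rat_root_of_monic_quadratic[OF m, rotated 2]) simp_all
  define w where "w = card (N x \<inter> N y) - (b + c)"
  have "(\<alpha> x * \<alpha> y)\<^sup>2 = (\<alpha> x)\<^sup>2 * (\<alpha> y)\<^sup>2" by (simp add: power_mult_distrib)
  then have "w\<^sup>2 = (card (N x) + b * c) * (card (N y) + b * c)"
    using adjacent_eq[OF p(1,6)] p by (simp add: degree_eq w_def)
  then have "w\<^sup>2 + 0 * w + - ((card (N x) + b * c) * (card (N y) + b * c)) = 0" by simp
  moreover have "w \<in> \<rat>" unfolding w_def using t by simp
  moreover have "- ((card (N x) + b * c) * (card (N y) + b * c)) \<in> \<int>" using mi by simp
  ultimately have "w \<in> \<int>" using rat_root_of_monic_quadratic Ints_0 by blast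
  then have "card (N x \<inter> N y) - w \<in> \<int>" by simp
  then show "b + c \<in> \<int>" by (simp add: w_def)
qed

end

section \<open>Valency and order\<close>

text \<open>The squares of \<open>x\<close> and of \<open>y - x\<close> are positive
  integers.\<close>

lemma integer_gap:
  fixes x y :: real
  assumes "0 < x" "x < y" "x\<^sup>2 \<in> \<int>" "x * y \<in> \<int>" "y\<^sup>2 \<in> \<int>"
  shows "x \<ge> 1" "y - x \<ge> 1"
proof -
  have sq_ge_1: "z \<ge> 1" if z: "z > 0" "z\<^sup>2 \<in> \<int>" for z :: real
  proof (rule power2_le_imp_le)
    obtain k where k: "z\<^sup>2 = of_int k" using z(2) by (rule Ints_cases)
    then have "k > 0" using z(1) by (metis of_int_0_less_iff zero_less_power)
    then show "1\<^sup>2 \<le> z\<^sup>2" unfolding k by simp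
  qed (use z in simp)
  show "x \<ge> 1" using sq_ge_1 assms by blast
  have "(y - x)\<^sup>2 = y\<^sup>2 - 2 * (x * y) + x\<^sup>2" by Groebner_Basis.algebra
  also have "\<dots> \<in> \<int>" by (intro Ints_add[OF Ints_diff[OF assms(5) Ints_mult[OF _ assms(4)]] assms(3)]) simp
  finally show "y - x \<ge> 1" using sq_ge_1[of "y - x"] assms by simp
qed

text \<open>Subtracting equations shows that two distinct values sum to the third. If
  \<open>y \<noteq> z\<close>, then \<open>x = y + z\<close> and in turn \<open>y = x + z\<close>,
  impossible for positive numbers.\<close>

lemma equal_if_same_norm_form:
  fixes x y z D :: real
  assumes "x > 0" "y > 0" "z > 0"
    and "x\<^sup>2 + y\<^sup>2 - x * y = D" "x\<^sup>2 + z\<^sup>2 - x * z = D" "y\<^sup>2 + z\<^sup>2 - y * z = D"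
  shows "y = z"
proof (rule ccontr)
  assume "y \<noteq> z"
  have "(y - z) * (y + z - x) = 0" using assms(4,5) by (simp add: algebra_simps power2_eq_square)
  then have x: "x = y + z" using \<open>y \<noteq> z\<close> by simp
  have "(x - z) * (x + z - y) = 0" using assms(4,6) by (simp add: algebra_simps power2_eq_square)
  then show False using x assms(1-3) by simp
qed

context rank_one_graph
begin

lemma products_integer: "x \<in> V \<Longrightarrow> y \<in> V \<Longrightarrow> \<alpha> x * \<alpha> y \<in> \<int>"
  using mult_integer add_integer by (simp add: gram)

lemma gap:
  assumes "x \<in> V" "y \<in> V" "\<alpha> y < \<alpha> x"
  shows "\<alpha> y \<ge> 1" "\<alpha> x - \<alpha> y \<ge> 1" "\<alpha> x \<le> 1 + \<alpha> y * (\<alpha> x - \<alpha> y)"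
proof -
  show 1: "\<alpha> y \<ge> 1" "\<alpha> x - \<alpha> y \<ge> 1"
    using integer_gap[OF pos[OF assms(2)] assms(3)] products_integer assms
    by (simp_all add: power2_eq_square)
  have "(\<alpha> y - 1) * (\<alpha> x - \<alpha> y - 1) \<ge> 0" using 1 by simp
  then show "\<alpha> x \<le> 1 + \<alpha> y * (\<alpha> x - \<alpha> y)" by (simp add: algebra_simps)
qed

lemma degree_less_iff:
  assumes "x \<in> V" "y \<in> V"
  shows "card (N y) < card (N x) \<longleftrightarrow> \<alpha> y < \<alpha> x"
proof -
  have "card (N y) < card (N x) \<longleftrightarrow> (\<alpha> y)\<^sup>2 < (\<alpha> x)\<^sup>2" using degree_eq assms by simp
  also have "\<dots> \<longleftrightarrow> \<alpha> y < \<alpha> x" using pos assms by (meson less_imp_le power2_less_imp_less power_strict_mono zero_less_numeral)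
  finally show ?thesis .
qed

lemma adjacent_bound:
  assumes x: "x \<in> V" and y: "y \<in> N x" and less: "\<alpha> y < \<alpha> x"
  shows "\<alpha> x \<le> 1 - (b + 1) * (c + 1)" and "b > - 1" "c < - 1"
proof -
  have yV: "y \<in> V" using N_in_V x y by blast
  \<comment> \<open>\<open>x\<close> is a neighbour of \<open>y\<close> but not a common one; this
    unit completes the product (b + 1)(c + 1).\<close>
  have "N x \<inter> N y \<subseteq> N y - {x}" using N_irrefl[OF x] by blast
  then have "card (N x \<inter> N y) \<le> card (N y - {x})"
    using finite_N[OF yV] by (intro card_mono) auto
  also have "\<dots> < card (N y)"
    using N_sym[OF x yV] y finite_N[OF yV] by (intro psubset_card_mono) auto
  finally have "real (card (N x \<inter> N y)) + 1 \<le> card (N y)" by linarith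
  then have *: "\<alpha> y * (\<alpha> x - \<alpha> y) \<le> - ((b + 1) * (c + 1))"
    using adjacent_eq[OF x y] degree_eq[OF yV] by (simp add: algebra_simps power2_eq_square)
  then show "\<alpha> x \<le> 1 - (b + 1) * (c + 1)" using gap(3)[OF x yV less] by simp
  have "\<alpha> y * (\<alpha> x - \<alpha> y) > 0" using pos[OF yV] less by simp
  then have "(b + 1) * (c + 1) < 0" using * by simp
  then have "0 < b + 1 \<and> c + 1 < 0 \<or> b + 1 < 0 \<and> 0 < c + 1" by (simp add: mult_less_0_iff)
  then show "b > - 1" "c < - 1" using bc by auto
qed

lemma nonadjacent_bound:
  assumes x: "x \<in> V" and y: "y \<in> V" "y \<notin> N x" and less: "\<alpha> y < \<alpha> x"
  shows "\<alpha> x \<le> 1 - b * c"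
proof -
  have "card (N x \<inter> N y) \<le> card (N y)"
    using finite_N[OF y(1)] by (intro card_mono) auto
  moreover have "\<alpha> x * \<alpha> y = card (N x \<inter> N y)"
    using nonadjacent_eq[OF x y(1) _ y(2)] less by blast
  ultimately have "\<alpha> y * (\<alpha> x - \<alpha> y) \<le> - (b * c)"
    using degree_eq[OF y(1)] by (simp add: algebra_simps power2_eq_square)
  then show ?thesis using gap(3)[OF x y(1) less] by simp
qed

text \<open>Every other vertex is a neighbour \<open>y\<close> of \<open>x\<close> or adjacent to
  one. Exchanging \<open>x\<close> for \<open>y\<close> in \<open>N y\<close> covers both kinds
  without raising the count.\<close>

lemma moore_bound:
  assumes x: "x \<in> V" and k: "\<And>y. y \<in> N x \<Longrightarrow> card (N y) \<le> k"
  shows "card V \<le> 1 + card (N x) * k"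
proof -
  have *: "card (insert y (N y - {x})) \<le> card (N y)" if "y \<in> N x" for y
  proof -
    have y: "y \<in> V" using N_in_V x that by blast
    have "x \<in> N y" using N_sym[OF x y] that by blast
    then have "card (N y - {x}) = card (N y) - 1" "card (N y) > 0"
      using finite_N[OF y] by (auto simp: card_gt_0_iff)
    then show ?thesis using finite_N[OF y] by (simp add: card_insert_if)
  qed
  have "V \<subseteq> insert x (\<Union>y\<in>N x. insert y (N y - {x}))"
  proof
    fix z assume z: "z \<in> V"
    show "z \<in> insert x (\<Union>y\<in>N x. insert y (N y - {x}))"
    proof (cases "z = x \<or> z \<in> N x")
      case False
      then obtain y where y: "y \<in> N x" "y \<in> N z" using common_neighbour[OF x z] by blast
      then have "z \<in> N y" using N_sym[OF _ z] N_in_V x by blast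
      then show ?thesis using y False by auto
    qed auto
  qed
  then have "card V \<le> card (insert x (\<Union>y\<in>N x. insert y (N y - {x})))"
    using finite_N x N_in_V by (intro card_mono) auto
  also have "\<dots> \<le> 1 + card (\<Union>y\<in>N x. insert y (N y - {x}))"
    by (cases "finite (\<Union>y\<in>N x. insert y (N y - {x}))") (auto simp: card_insert_if)
  also have "card (\<Union>y\<in>N x. insert y (N y - {x})) \<le> (\<Sum>y\<in>N x. card (insert y (N y - {x})))"
    using finite_N[OF x] by (rule card_UN_le)
  also have "\<dots> \<le> (\<Sum>y\<in>N x. k)" using * k by (intro sum_mono) (meson le_trans)
  finally show ?thesis by simp
qed

text \<open>Inclusion-exclusion cancels the valencies against the common neighbours, so the
  quadratic form takes the same value for every such pair.\<close>

lemma joined_eq: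
  assumes x: "x \<in> V" and y: "y \<in> V" and un: "N x \<union> N y = V"
  shows "(\<alpha> x)\<^sup>2 + (\<alpha> y)\<^sup>2 - \<alpha> x * \<alpha> y = card V + 2 * (b * c) + (b + c)"
proof -
  have "y \<in> N x" using un y N_irrefl[OF y] by blast
  moreover have "card (N x) + card (N y) = card V + card (N x \<inter> N y)"
    using card_Un_Int[OF finite_N[OF x] finite_N[OF y]] un by simp
  ultimately show ?thesis using adjacent_eq[OF x] degree_eq x y by simp
qed

lemma card_V_bound_by_max_degree:
  assumes x: "x \<in> V" "card (N x) = k" and max: "\<And>y. y \<in> V \<Longrightarrow> card (N y) \<le> k"
    and K: "real k \<le> K"
  shows "real (card V) \<le> (K - 1)\<^sup>2 + 1"
proof -
  obtain y where y: "y \<in> V" "card (N y) < k" using not_regular max by (metis le_neq_implies_less)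
  then have less: "\<alpha> y < \<alpha> x" using degree_less_iff[OF x(1) y(1)] x(2) by simp
  have g: "\<alpha> y \<ge> 1" "\<alpha> x - \<alpha> y \<ge> 1" using gap[OF x(1) y(1) less] by auto
  \<comment> \<open>The gap of at least 1 makes the valency of \<open>y\<close> at most
    \<open>k - 2\<close>, so counting from \<open>y\<close> gives 1 + (k - 2)k, which is (k -
    1)^2.\<close>
  have "(\<alpha> x)\<^sup>2 - (\<alpha> y)\<^sup>2 = (\<alpha> x - \<alpha> y) * (\<alpha> x + \<alpha> y)" by Groebner_Basis.algebra
  also have "\<dots> \<ge> 1 * (\<alpha> x + \<alpha> y)" using g by (intro mult_right_mono) auto
  finally have "(\<alpha> x)\<^sup>2 - (\<alpha> y)\<^sup>2 \<ge> 2" using g by simp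
  then have d: "real (card (N y)) \<le> real k - 2" using degree_eq x y by auto
  then have "k \<ge> 2" by linarith
  have "real (card V) \<le> real (1 + card (N y) * k)"
    using moore_bound[OF y(1), of k] max N_in_V[OF y(1)] by (simp only: of_nat_le_iff)
  also have "\<dots> \<le> 1 + (real k - 2) * k" using d by (simp add: mult_right_mono)
  also have "\<dots> \<le> (real k - 1)\<^sup>2 + 1" by (simp add: power2_eq_square algebra_simps)
  also have "\<dots> \<le> (K - 1)\<^sup>2 + 1" using K \<open>k \<ge> 2\<close> by (intro add_right_mono power_mono) auto
  finally show ?thesis .
qed

end

section \<open>The order when the vertices of maximal valency are joined to all others\<close>

context rank_one_graph
begin

text \<open>The pair \<open>p\<close>, \<open>q\<close> controls both sides: \<open>V1\<close>
  consists of common neighbours of the two, and \<open>nonadjacent_bound\<close> limits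
  \<open>\<alpha> p\<close> and thereby also \<open>V2\<close>.\<close>

lemma two_valued_join_bound:
  assumes V: "V = V1 \<union> V2" and p: "p \<in> V" and q: "q \<in> V" and pq: "q \<notin> N p" "\<alpha> q < \<alpha> p"
    and V1: "V1 \<subseteq> N p \<inter> N q" and V2: "real (card V2) \<le> (\<alpha> p + \<alpha> q)\<^sup>2"
  shows "real (card V) \<le> ((1 - b * c)\<^sup>2 - b * c - 1)\<^sup>2 + 1"
proof -
  define B where "B = 1 - b * c"
  have pB: "\<alpha> p \<le> B" unfolding B_def using nonadjacent_bound[OF p q pq] .
  have g: "\<alpha> q \<ge> 1" "\<alpha> p - \<alpha> q \<ge> 1" using gap[OF p q pq(2)] by auto
  then have B: "B \<ge> 2" using pB by simp
  have "card V1 \<le> card (N p \<inter> N q)" using V1 finite_N[OF p] by (intro card_mono) auto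
  moreover have "\<alpha> p * \<alpha> q = card (N p \<inter> N q)"
    using nonadjacent_eq[OF p q _ pq(1)] pq(2) by blast
  ultimately have "real (card V1) \<le> \<alpha> p * \<alpha> q" by simp
  also have "\<dots> \<le> B * (B - 1)" using pB g by (intro mult_mono) auto
  finally have "real (card V1) \<le> B * (B - 1)" .
  moreover have "(\<alpha> p + \<alpha> q)\<^sup>2 \<le> (2 * B - 1)\<^sup>2" using pB g by (intro power_mono) auto
  moreover have "real (card V) \<le> card V1 + card V2"
    unfolding V using card_Un_le of_nat_mono by (metis of_nat_add of_nat_le_iff)
  ultimately have "real (card V) \<le> B * (B - 1) + (2 * B - 1)\<^sup>2" using V2 by linarith
  also have "\<dots> = (B - 1) * (5 * B) + 1" by (simp add: algebra_simps power2_eq_square)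
  \<comment> \<open>Since \<open>b * c = 1 - B\<close>, the target base B^2 - bc - 1 factors as (B -
    1)(B + 2).\<close>
  also have "\<dots> \<le> (B - 1) * ((B - 1) * (B + 2)\<^sup>2) + 1"
  proof -
    have "5 * B \<le> 1 * (B + 2)\<^sup>2"
      using zero_le_power2[of "B - 2"] B by (simp add: algebra_simps power2_eq_square)
    also have "\<dots> \<le> (B - 1) * (B + 2)\<^sup>2" using B by (intro mult_right_mono) auto
    finally show ?thesis using B by (intro add_right_mono mult_left_mono) auto
  qed
  also have "\<dots> = (B\<^sup>2 - b * c - 1)\<^sup>2 + 1" unfolding B_def by Groebner_Basis.algebra
  finally show ?thesis unfolding B_def .
qed

text \<open>
  If both sides of the join are regular, then the quotient matrix of the partition has, besides \<open>a\<close>,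
  one of \<open>b\<close> and \<open>c\<close> as eigenvalue; below \<open>\<theta>\<close> denotes the other one of these two.
\<close>

lemma biregular_join_impossible:
  assumes V: "V = V1 \<union> V2" "V1 \<inter> V2 = {}"
    and const: "\<And>x. x \<in> V1 \<Longrightarrow> \<alpha> x = M" "\<And>y. y \<in> V2 \<Longrightarrow> \<alpha> y = \<beta>"
    and less: "\<beta> < M" and join: "\<And>x y. x \<in> V1 \<Longrightarrow> y \<in> V2 \<Longrightarrow> y \<in> N x"
    and x: "x \<in> V1" and x': "x' \<in> V1" "x' \<noteq> x" "x' \<notin> N x" and y: "y \<in> V2"
  shows False
proof -
  have xV: "x \<in> V" "x' \<in> V" and yV: "y \<in> V" using x x' y V by auto
  have sub: "V2 \<subseteq> N x" if "x \<in> V1" for x using join that by blast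
  have sub': "V1 \<subseteq> N y" if "y \<in> V2" for y using join N_sym that V by blast
  define m t where "m = b * c" and "t = b + c"
  define n1 n2 where "n1 = real (card V1)" and "n2 = real (card V2)"
  \<comment> \<open>The valencies inside the two sides; the join contributes \<open>n2\<close> and
    \<open>n1\<close>.\<close>
  define r1 r2 where "r1 = card (N x) - n2" and "r2 = card (N y) - n1"
  have fin: "finite V1" "finite V2" using V finite_V by (metis finite_Un)+
  have cardV: "real (card V) = n1 + n2"
    unfolding n1_def n2_def V(1) using card_Un_disjoint[OF fin V(2)] by simp
  have M: "\<alpha> x = M" "\<alpha> x' = M" "\<alpha> y = \<beta>" using const x x' y by auto
  have pos': "0 < \<beta>" "0 < M" using pos[OF yV] pos[OF xV(1)] M by auto
  have M2: "M\<^sup>2 = r1 + n2 + m" and \<beta>2: "\<beta>\<^sup>2 = r2 + n1 + m"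
    using degree_eq[OF xV(1)] degree_eq[OF yV] unfolding M m_def r1_def r2_def by simp_all
  have "N x \<union> N y = V" using sub[OF x] sub'[OF y] N_subset[OF xV(1)] N_subset[OF yV] V by blast
  then have "M\<^sup>2 + \<beta>\<^sup>2 - M * \<beta> = n1 + n2 + 2 * m + t"
    using joined_eq[OF xV(1) yV] unfolding M cardV m_def t_def by simp
  then have M\<beta>: "M * \<beta> = r1 + r2 - t" unfolding M2 \<beta>2 by simp
  have sum_N: "(\<Sum>z\<in>N u. \<alpha> z) = (card (N u) - real (card B)) * p + real (card B) * q"
    if "u \<in> V" "B \<subseteq> N u" "\<And>z. z \<in> N u - B \<Longrightarrow> \<alpha> z = p" "\<And>z. z \<in> B \<Longrightarrow> \<alpha> z = q" for u B and p q :: real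
  proof -
    have f: "finite (N u)" "finite B" using finite_N that finite_subset by blast+
    have "(\<Sum>z\<in>N u. \<alpha> z) = (\<Sum>z\<in>N u - B. \<alpha> z) + (\<Sum>z\<in>B. \<alpha> z)"
      using f that(2) by (metis sum.subset_diff)
    also have "\<dots> = real (card (N u - B)) * p + real (card B) * q" using that(3,4) by simp
    also have "real (card (N u - B)) = card (N u) - real (card B)"
      using f that(2) card_mono[of "N u" B] by (simp add: card_Diff_subset of_nat_diff)
    finally show ?thesis .
  qed
  have "\<alpha> z = M" if "z \<in> N x - V2" for z
    using const(1) that N_subset[OF xV(1)] V by blast
  note sum_Nx = sum_N[OF xV(1) sub[OF x] this const(2)]
  have "\<alpha> z = \<beta>" if "z \<in> N y - V1" for z
    using const(2) that N_subset[OF yV] V by blast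
  note sum_Ny = sum_N[OF yV sub'[OF y] this const(1)]
  have e1: "r1 * M + n2 * \<beta> = a * M"
    using sum_Nx eigenvector[OF xV(1)] unfolding M r1_def n2_def by simp
  have e2: "r2 * \<beta> + n1 * M = a * \<beta>"
    using sum_Ny eigenvector[OF yV] unfolding M r2_def n1_def by simp
  have "(\<Sum>z\<in>V. (\<alpha> z)\<^sup>2) = (\<Sum>z\<in>V1. (\<alpha> z)\<^sup>2) + (\<Sum>z\<in>V2. (\<alpha> z)\<^sup>2)"
    unfolding V(1) using fin V(2) by (intro sum.union_disjoint)
  also have "\<dots> = n1 * M\<^sup>2 + n2 * \<beta>\<^sup>2" unfolding n1_def n2_def using const by simp
  finally have sq: "n1 * M\<^sup>2 + n2 * \<beta>\<^sup>2 = (a - b) * (a - c)" using square_sum by simp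
  \<comment> \<open>The quotient matrix has trace \<open>r1 + r2\<close>, so its second eigenvalue
    is \<open>r1 + r2 - a\<close>, here subtracted from \<open>b + c\<close>.\<close>
  define \<theta> where "\<theta> = t + a - r1 - r2"
  have "n1 * M\<^sup>2 + n2 * \<beta>\<^sup>2 = M * \<beta> * (2 * a - r1 - r2)"
    using e1 e2 by Groebner_Basis.algebra
  then have "(\<theta> - b) * (\<theta> - c) = 0"
    unfolding sq M\<beta> \<theta>_def t_def by Groebner_Basis.algebra
  then have \<theta>: "\<theta> = b \<or> \<theta> = c" by simp
  \<comment> \<open>Eliminate \<open>n2\<close> from \<open>e1\<close> and \<open>n1\<close> from
    \<open>e2\<close>.\<close>
  have q1: "(r1 + m) * \<beta> = M * (r1 - \<theta>)" and q2: "(r2 + m) * M = \<beta> * (r2 - \<theta>)"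
    using e1 e2 M2 \<beta>2 M\<beta> unfolding \<theta>_def by Groebner_Basis.algebra+
  have xx': "M * M = card (N x \<inter> N x')"
    using nonadjacent_eq[OF xV] x'(2,3) unfolding M by auto
  \<comment> \<open>All of \<open>V2\<close> is common to the nonadjacent \<open>x\<close> and
    \<open>x'\<close>, which makes \<open>r1 + m\<close> nonnegative.\<close>
  have "V2 \<subseteq> N x \<inter> N x'" using sub x x'(1) by blast
  then have "n2 \<le> M * M"
    unfolding xx' n2_def using finite_N[OF xV(1)] by (simp add: card_mono)
  then have r1m: "r1 + m \<ge> 0" using M2 by (simp add: power2_eq_square)
  have yNx: "y \<in> N x" using join x y by blast
  have bc': "b > - 1" "c < - 1"
    using adjacent_bound(2,3)[OF xV(1) yNx] less unfolding M by auto
  have "- \<theta> \<le> m"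
  proof (rule ccontr)
    assume "\<not> - \<theta> \<le> m"
    then have gt: "r1 - \<theta> > r1 + m" by simp
    have "\<beta> * (r1 + m) < \<beta> * (r1 - \<theta>)" using gt pos' by simp
    also have "\<dots> < M * (r1 - \<theta>)" using less gt r1m by simp
    finally show False using q1 by (simp add: mult.commute)
  qed
  \<comment> \<open>Together with the preceding inequality this excludes
    \<open>\<theta> = c\<close>.\<close>
  moreover have "- c > m"
  proof -
    have "(- c) * (1 + b) > 0" using bc' by (intro mult_pos_pos) auto
    then show ?thesis by (simp add: m_def algebra_simps)
  qed
  ultimately have \<theta>b: "\<theta> = b" "b * (1 + c) \<ge> 0" using \<theta> by (auto simp: m_def algebra_simps)
  then have "b \<le> 0" using bc' by (simp add: zero_le_mult_iff)
  moreover have "m \<le> 0"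
  proof -
    have "card (N x \<inter> N x') \<le> card (N x)" using finite_N[OF xV(1)] by (intro card_mono) auto
    then have "M * M \<le> M\<^sup>2 - m" unfolding xx' using degree_eq[OF xV(1)] M m_def by simp
    then show ?thesis by (simp add: power2_eq_square)
  qed
  ultimately have "b = 0" using bc' by (auto simp: m_def mult_le_0_iff)
  then have "m = 0" "\<theta> = 0" using \<theta>b by (auto simp: m_def)
  \<comment> \<open>\<open>q1\<close> and \<open>q2\<close> now read
    \<open>r1 * \<beta> = M * r1\<close> and \<open>r2 * M = \<beta> * r2\<close>, so both sides are
    independent sets and the graph is bipartite.\<close>
  then have r: "r1 = 0" "r2 = 0" using q1 q2 less by auto
  show False
  proof (rule not_bipartite[of V1 V2])
    fix z assume z: "z \<in> V1"
    then have zV: "z \<in> V" using V by blast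
    have "real (card (N z)) = card (N x)"
      using degree_eq[OF zV] degree_eq[OF xV(1)] const(1)[OF z] M by simp
    then have "card (N z) = card V2" using r unfolding r1_def n2_def by simp
    then show "N z \<subseteq> V2" using sub[OF z] finite_N[OF zV] by (metis card_subset_eq subset_refl)
  next
    fix z assume z: "z \<in> V2"
    then have zV: "z \<in> V" using V by blast
    have "real (card (N z)) = card (N y)"
      using degree_eq[OF zV] degree_eq[OF yV] const(2)[OF z] M by simp
    then have "card (N z) = card V1" using r unfolding r2_def n1_def by simp
    then show "N z \<subseteq> V1" using sub'[OF z] finite_N[OF zV] by (metis card_subset_eq subset_refl)
  qed (use V in auto)
qed

text \<open>By \<open>joined_eq\<close> with \<open>x\<close> fixed, every value of
  \<open>\<alpha>\<close> on \<open>V2\<close> is a root of one quadratic. A single value is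
  excluded by \<open>biregular_join_impossible\<close>; two values sum to \<open>\<alpha> x\<close>,
  and a nonadjacent pair carrying them leads to \<open>two_valued_join_bound\<close>.\<close>

lemma join_bound:
  assumes x: "x \<in> V" and max: "\<And>y. y \<in> V \<Longrightarrow> \<alpha> y \<le> \<alpha> x"
    and join: "\<And>z y. z \<in> V \<Longrightarrow> y \<in> V \<Longrightarrow> \<alpha> z = \<alpha> x \<Longrightarrow> \<alpha> y < \<alpha> x \<Longrightarrow> y \<in> N z"
    and non_dominating: "\<exists>x'\<in>V. x' \<noteq> x \<and> x' \<notin> N x"
  shows "real (card V) \<le> ((1 - b * c)\<^sup>2 - b * c - 1)\<^sup>2 + 1"
proof -
  define V1 V2 where "V1 = {z \<in> V. \<alpha> z = \<alpha> x}" and "V2 = {y \<in> V. \<alpha> y < \<alpha> x}"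
  have V: "V = V1 \<union> V2" "V1 \<inter> V2 = {}" unfolding V1_def V2_def using max by force+
  have V12: "V1 \<subseteq> V" "V2 \<subseteq> V" using V by auto
  have join': "y \<in> N z" "z \<in> N y" if "z \<in> V1" "y \<in> V2" for z y
    using join[of z y] that N_sym[of z y] unfolding V1_def V2_def by auto
  have x1: "x \<in> V1" using x by (simp add: V1_def)
  obtain x' where x': "x' \<in> V1" "x' \<noteq> x" "x' \<notin> N x"
    using non_dominating join'(1)[OF x1] V by blast
  have V2_ne: "V2 \<noteq> {}"
  proof
    assume "V2 = {}"
    then have "V = V1" using V(1) by simp
    then have "\<alpha> z = \<alpha> x" if "z \<in> V" for z using that unfolding V1_def by blast
    then have "real (card (N z)) = (\<alpha> x)\<^sup>2 - b * c" if "z \<in> V" for z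
      using degree_eq[OF that] that by simp
    then show False using not_regular by (metis of_nat_eq_iff)
  qed
  have joined: "(\<alpha> x)\<^sup>2 + (\<alpha> y)\<^sup>2 - \<alpha> x * \<alpha> y = card V + 2 * (b * c) + (b + c)" if "y \<in> V2" for y
  proof (rule joined_eq[OF x])
    show "y \<in> V" using that V12 by blast
    have "N x \<subseteq> V" "N y \<subseteq> V" using N_subset x that V12 by blast+
    then show "N x \<union> N y = V" using join'(1)[OF x1] join'(2)[OF _ that] V by blast
  qed
  show ?thesis
  proof (cases "\<exists>y\<in>V2. \<exists>z\<in>V2. \<alpha> y \<noteq> \<alpha> z")
    case False
    obtain y where y: "y \<in> V2" using V2_ne by blast
    have "\<alpha> z = \<alpha> y" if "z \<in> V2" for z using False that y by blast
    moreover have "\<alpha> y < \<alpha> x" using y by (simp add: V2_def)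
    moreover have "\<alpha> z = \<alpha> x" if "z \<in> V1" for z using that by (simp add: V1_def)
    ultimately show ?thesis
      using biregular_join_impossible[OF V _ _ _ join'(1) x1 x' y] by blast
  next
    case True
    then obtain y z where yz: "y \<in> V2" "z \<in> V2" "\<alpha> y \<noteq> \<alpha> z" by blast
    have conj: "\<alpha> x = \<alpha> u + \<alpha> v" if "u \<in> V2" "v \<in> V2" "\<alpha> u \<noteq> \<alpha> v" for u v
    proof -
      have "(\<alpha> u - \<alpha> v) * (\<alpha> u + \<alpha> v - \<alpha> x) = 0"
        using joined[OF that(1)] joined[OF that(2)] by (simp add: algebra_simps power2_eq_square)
      then show ?thesis using that(3) by simp
    qed
    \<comment> \<open>If distinct values always meant adjacency, the neighbourhoods of
      \<open>y\<close> and \<open>z\<close> would cover \<open>V\<close>, and \<open>x\<close>,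
      \<open>y\<close>, \<open>z\<close> would satisfy one norm equation pairwise.\<close>
    have "\<exists>p\<in>V2. \<exists>q\<in>V2. \<alpha> p \<noteq> \<alpha> q \<and> q \<notin> N p"
    proof (rule ccontr)
      assume "\<not> ?thesis"
      then have adj: "q \<in> N p" if "p \<in> V2" "q \<in> V2" "\<alpha> p \<noteq> \<alpha> q" for p q using that by blast
      have yzV: "y \<in> V" "z \<in> V" using yz V12 by auto
      have "w \<in> N y \<union> N z" if "w \<in> V" for w
      proof (cases "w \<in> V1")
        case True
        then show ?thesis using join'(2)[OF _ yz(1)] by blast
      next
        case False
        then have "w \<in> V2" using that V(1) by blast
        then show ?thesis
          using adj[OF yz(1)] adj[OF yz(2)] yz(3) by (cases "\<alpha> w = \<alpha> y") auto
      qed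
      then have "N y \<union> N z = V" using N_subset yzV by blast
      note e = joined_eq[OF yzV this]
      have "\<alpha> y = \<alpha> z"
        by (rule equal_if_same_norm_form[OF _ _ _ joined[OF yz(1)] joined[OF yz(2)] e])
          (use pos x yzV in auto)
      then show False using yz(3) by simp
    qed
    then obtain p0 q0 where pq0: "p0 \<in> V2" "q0 \<in> V2" "\<alpha> p0 \<noteq> \<alpha> q0" "q0 \<notin> N p0" by blast
    obtain p q where pq: "p \<in> V2" "q \<in> V2" "\<alpha> q < \<alpha> p" "q \<notin> N p"
    proof (cases "\<alpha> q0 < \<alpha> p0")
      case False
      then show ?thesis using that[of q0 p0] pq0 N_sym[of p0 q0] V12 by auto
    qed (use that pq0 in blast)
    have pqV: "p \<in> V" "q \<in> V" using pq V12 by auto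
    \<comment> \<open>\<open>V2\<close> lies in the common neighbourhood of two nonadjacent vertices
      of maximal value, of size \<open>\<alpha> x * \<alpha> x\<close>.\<close>
    have "V2 \<subseteq> N x \<inter> N x'" using join'(1) x1 x'(1) by blast
    then have "real (card V2) \<le> card (N x \<inter> N x')"
      using finite_N[OF x] by (simp add: card_mono)
    also have "\<dots> = \<alpha> x * \<alpha> x"
      using nonadjacent_eq[of x x'] x x' by (auto simp: V1_def)
    also have "\<dots> = (\<alpha> p + \<alpha> q)\<^sup>2" using conj[OF pq(1,2)] pq(3) by (simp add: power2_eq_square)
    finally have "real (card V2) \<le> (\<alpha> p + \<alpha> q)\<^sup>2" .
    moreover have "V1 \<subseteq> N p \<inter> N q" using join'(2) pq by blast
    ultimately show ?thesis using two_valued_join_bound[OF V(1) pqV pq(4,3)] by blast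
  qed
qed

text \<open>Connectedness yields an edge leaving the set \<open>S\<close> of vertices of maximal
  valency; connectedness of the complement, phrased by closed sets, yields a nonadjacent pair
  leaving it. For the order, \<open>\<alpha> x > l\<close> rules out such a pair, so the graph is a
  join.\<close>

theorem valency_and_order_bounds:
  assumes kmax: "\<And>x. x \<in> V \<Longrightarrow> card (N x) \<le> k" "\<exists>x\<in>V. card (N x) = k"
    and l: "l = min (1 - (b + 1) * (c + 1)) (1 - b * c)"
  shows "real k \<le> (1 - (b + 1) * (c + 1))\<^sup>2 - b * c"
    and "(\<And>S. S \<subseteq> V \<Longrightarrow> S \<noteq> {} \<Longrightarrow> (\<And>x y. x \<in> S \<Longrightarrow> y \<in> V \<Longrightarrow> y \<notin> N x \<Longrightarrow> y \<in> S) \<Longrightarrow> S = V)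
      \<Longrightarrow> real k \<le> l\<^sup>2 - b * c"
    and "real (card V) \<le> max ((l\<^sup>2 - b * c - 1)\<^sup>2 + 1) ((1 - (b + 1) * (c + 1))\<^sup>2 - b * c + 1)"
proof -
  define L where "L = 1 - (b + 1) * (c + 1)"
  obtain x where x: "x \<in> V" "card (N x) = k" using kmax(2) by blast
  define S where "S = {z \<in> V. card (N z) = k}"
  have xS: "S \<noteq> {}" "S \<subseteq> V" using x by (auto simp: S_def)
  have S_ne: "S \<noteq> V"
  proof
    assume "S = V"
    then have "card (N z) = k" if "z \<in> V" for z using that unfolding S_def by blast
    then show False using not_regular by auto
  qed
  have S_iff: "z \<in> S \<longleftrightarrow> \<alpha> z = \<alpha> x" and less_iff: "z \<notin> S \<longleftrightarrow> \<alpha> z < \<alpha> x" if "z \<in> V" for z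
    using that degree_less_iff[OF x(1) that] degree_less_iff[OF that x(1)] kmax(1)[OF that] x(2)
    by (auto simp: S_def)
  have k: "real k = (\<alpha> x)\<^sup>2 - b * c" using degree_eq[OF x(1)] x(2) by simp
  have kbound: "real k \<le> r\<^sup>2 - b * c" if "\<alpha> x \<le> r" for r
    unfolding k using that pos[OF x(1)] by (simp add: power_mono)
  have L: "\<alpha> x \<le> L"
  proof -
    obtain u v where uv: "u \<in> S" "v \<in> N u" "v \<notin> S" using connected[OF xS(2,1)] S_ne by blast
    have "v \<in> V" "u \<in> V" using uv xS(2) N_in_V by blast+
    then show ?thesis using adjacent_bound(1)[of u v] uv S_iff less_iff unfolding L_def by auto
  qed
  then show i: "real k \<le> (1 - (b + 1) * (c + 1))\<^sup>2 - b * c" using kbound by (simp add: L_def)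
  have nonadj: "\<alpha> x \<le> l" if uv: "u \<in> S" "v \<in> V" "v \<notin> N u" "v \<notin> S" for u v
  proof -
    have "u \<in> V" using uv xS by blast
    then have "\<alpha> x \<le> 1 - b * c"
      using nonadjacent_bound[of u v] uv S_iff less_iff by auto
    then show ?thesis using L by (simp add: l L_def)
  qed
  {
    assume *: "\<And>S. S \<subseteq> V \<Longrightarrow> S \<noteq> {} \<Longrightarrow>
      (\<And>x y. x \<in> S \<Longrightarrow> y \<in> V \<Longrightarrow> y \<notin> N x \<Longrightarrow> y \<in> S) \<Longrightarrow> S = V"
    have "\<alpha> x \<le> l" using *[OF xS(2,1)] S_ne nonadj by blast
    then show "real k \<le> l\<^sup>2 - b * c" by (rule kbound)
  }
  show "real (card V) \<le> max ((l\<^sup>2 - b * c - 1)\<^sup>2 + 1) ((1 - (b + 1) * (c + 1))\<^sup>2 - b * c + 1)"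
  proof (cases "\<alpha> x \<le> l")
    case True
    then have "real (card V) \<le> (l\<^sup>2 - b * c - 1)\<^sup>2 + 1"
      using card_V_bound_by_max_degree[OF x kmax(1) kbound] by blast
    then show ?thesis by simp
  next
    case False
    \<comment> \<open>As \<open>L\<close> is at least \<open>\<alpha> x\<close> but \<open>l\<close>
      is not, the minimum is the other term.\<close>
    then have l': "l = 1 - b * c" using L by (auto simp: l L_def)
    show ?thesis
    proof (cases "\<exists>x'\<in>V. x' \<noteq> x \<and> x' \<notin> N x")
      case True
      have "real (card V) \<le> ((1 - b * c)\<^sup>2 - b * c - 1)\<^sup>2 + 1"
      proof (rule join_bound[OF x(1) _ _ True])
        show "\<alpha> y \<le> \<alpha> x" if "y \<in> V" for y
          using S_iff[OF that] less_iff[OF that] by auto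
        show "y \<in> N z" if "z \<in> V" "y \<in> V" "\<alpha> z = \<alpha> x" "\<alpha> y < \<alpha> x" for z y
          using nonadj[of z y] False that S_iff less_iff by blast
      qed
      then show ?thesis unfolding l' by simp
    next
      case dominating: False
      have "V \<subseteq> insert x (N x)" using dominating by blast
      then have "card V \<le> card (insert x (N x))" using finite_N[OF x(1)] by (intro card_mono) auto
      also have "\<dots> \<le> k + 1" using x finite_N[OF x(1)] by (simp add: card_insert_if)
      finally have "real (card V) \<le> real k + 1" by linarith
      then show ?thesis using i by simp
    qed
  qed
qed

end

section \<open>Transfer to pair graphs\<close>

definition neighbours :: "'a pair_pre_digraph \<Rightarrow> 'a \<Rightarrow> 'a set" where
  "neighbours G x = {y. (x, y) \<in> parcs G}"

lemma (in pair_graph) neighbourhood_graph: "neighbourhood_graph (pverts G) (neighbours G)"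
proof
  have "sym (parcs G)" using pair_sym_arcs by (simp add: symmetric_def)
  then show "y \<in> neighbours G x \<longleftrightarrow> x \<in> neighbours G y" for x y
    by (auto simp: neighbours_def dest: symD)
qed (auto simp: neighbours_def pair_finite_verts dest: in_arcsD2 pair_no_loops)

lemma valency_eq_card_neighbours: "valency G x = card (neighbours G x)"
proof -
  have "out_arcs (with_proj G) x = Pair x ` neighbours G x"
    by (auto simp: out_arcs_def neighbours_def)
  then show ?thesis by (simp add: out_degree_def card_image inj_on_def)
qed

lemma connected_graph_closed_set:
  assumes "connected_graph G" "S \<subseteq> pverts G" "S \<noteq> {}"
    and closed: "\<And>x y. x \<in> S \<Longrightarrow> y \<in> pverts G \<Longrightarrow> (x, y) \<in> parcs G \<or> (y, x) \<in> parcs G \<Longrightarrow> y \<in> S"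
  shows "S = pverts G"
proof -
  obtain u where u: "u \<in> S" using assms(3) by blast
  have "v \<in> S" if v: "v \<in> pverts G" for v
  proof -
    have "(u, v) \<in> rtrancl_on (pverts G) ((parcs G)\<^sup>s)"
      using assms(1,2) u v by (auto simp: connected_conv)
    then show ?thesis
    proof (induction rule: rtrancl_on_induct)
      case (step y z)
      then show ?case using closed[of y z] by (auto simp: symcl_def)
    qed (use u in auto)
  qed
  then show ?thesis using assms(2) by blast
qed

theorem proposition3p3:
  fixes \<Gamma> :: "'a pair_pre_digraph"
    and \<theta>\<^sub>0 \<theta>\<^sub>1 \<theta>\<^sub>2 l :: real
    and n kmax :: nat
  assumes "\<theta>\<^sub>0 > \<theta>\<^sub>1" and "\<theta>\<^sub>1 > \<theta>\<^sub>2"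
    and "\<Gamma> \<in> three_eigenvalue_graphs \<theta>\<^sub>0 \<theta>\<^sub>1 \<theta>\<^sub>2"
    and "card (pverts \<Gamma>) = n"
    and "\<not> bipartite_graph \<Gamma>"
    and "kmax = max_valency \<Gamma>"
    and "l = min (1 - (\<theta>\<^sub>1 + 1) * (\<theta>\<^sub>2 + 1)) (- \<theta>\<^sub>1 * \<theta>\<^sub>2 + 1)"
  shows "real kmax \<le> (1 - (\<theta>\<^sub>1 + 1) * (\<theta>\<^sub>2 + 1))\<^sup>2 - \<theta>\<^sub>1 * \<theta>\<^sub>2
    \<and> (connected_graph (complement_graph \<Gamma>) \<longrightarrow> real kmax \<le> l\<^sup>2 - \<theta>\<^sub>1 * \<theta>\<^sub>2)
    \<and> real n \<le> max ((l\<^sup>2 - \<theta>\<^sub>1 * \<theta>\<^sub>2 - 1)\<^sup>2 + 1)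
                    ((1 - (\<theta>\<^sub>1 + 1) * (\<theta>\<^sub>2 + 1))\<^sup>2 - \<theta>\<^sub>1 * \<theta>\<^sub>2 + 1)"
proof -
  let ?V = "pverts \<Gamma>" and ?N = "neighbours \<Gamma>"
  interpret pair_graph \<Gamma> using assms(3) by (simp add: three_eigenvalue_graphs_def)
  interpret neighbourhood_graph ?V ?N by (rule neighbourhood_graph)
  have conn: "connected_graph \<Gamma>" and nonreg: "\<not> regular_graph \<Gamma>"
    and spec: "graph_spectrum \<Gamma> = {\<theta>\<^sub>0, \<theta>\<^sub>1, \<theta>\<^sub>2}"
    using assms(3) by (simp_all add: three_eigenvalue_graphs_def)
  have closed: "S = ?V" if "S \<subseteq> ?V" "S \<noteq> {}" "\<And>x. x \<in> S \<Longrightarrow> ?N x \<subseteq> S" for S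
  proof (rule connected_graph_closed_set[OF conn that(1,2)])
    fix x y assume x: "x \<in> S" and y: "y \<in> ?V" "(x, y) \<in> parcs \<Gamma> \<or> (y, x) \<in> parcs \<Gamma>"
    have "x \<in> ?V" using x that(1) by blast
    then have "y \<in> ?N x" using y N_sym[of x y] by (auto simp: neighbours_def)
    then show "y \<in> S" using that(3)[OF x] by blast
  qed
  \<comment> \<open>The same choice of enumeration as in \<open>graph_spectrum\<close>, so the
    spectrum transfers directly.\<close>
  define vs where "vs = (SOME vs. distinct vs \<and> set vs = ?V)"
  have vs: "distinct vs" "set vs = ?V"
    using someI_ex[of "\<lambda>vs. distinct vs \<and> set vs = ?V"] finite_distinct_list[OF finite_V]
    unfolding vs_def by blast+
  have "adjacency_matrix \<Gamma> vs = nbh_mat vs"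
    by (simp add: adjacency_matrix_def nbh_mat_def neighbours_def)
  then have "spectrum (nbh_mat vs) = {\<theta>\<^sub>0, \<theta>\<^sub>1, \<theta>\<^sub>2}"
    using spec unfolding graph_spectrum_def vs_def by simp
  then interpret three_eigenvalue_nbh ?V ?N \<theta>\<^sub>0 \<theta>\<^sub>1 \<theta>\<^sub>2
    by (rule three_eigenvalue_nbhI[OF assms(1,2) closed vs, rotated -1])
  obtain \<alpha> where \<alpha>: "\<forall>x\<in>?V. \<alpha> x > 0" "eigfun \<theta>\<^sub>0 \<alpha>"
    "(\<Sum>x\<in>?V. (\<alpha> x)\<^sup>2) = (\<theta>\<^sub>0 - \<theta>\<^sub>1) * (\<theta>\<^sub>0 - \<theta>\<^sub>2)"
    "\<forall>x\<in>?V. \<forall>y\<in>?V. \<alpha> x * \<alpha> y = card (?N x \<inter> ?N y)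
      - (if y \<in> ?N x then \<theta>\<^sub>1 + \<theta>\<^sub>2 else 0) + (if x = y then \<theta>\<^sub>1 * \<theta>\<^sub>2 else 0)"
    by (rule perron_vector)
  interpret rank_one_graph ?V ?N \<theta>\<^sub>0 \<theta>\<^sub>1 \<theta>\<^sub>2 \<alpha>
  proof
    show "\<exists>x\<in>?V. \<exists>y\<in>?V. card (?N x) \<noteq> card (?N y)"
      using nonreg unfolding regular_graph_def valency_eq_card_neighbours by metis
    show "(\<Sum>y\<in>?N x. \<alpha> y) = \<theta>\<^sub>0 * \<alpha> x" if "x \<in> ?V" for x
      using \<alpha>(2) that by (simp add: eigfun_def adj_def)
    fix X Y assume XY: "X \<union> Y = ?V" "X \<inter> Y = {}"
      "\<And>x. x \<in> X \<Longrightarrow> ?N x \<subseteq> Y" "\<And>y. y \<in> Y \<Longrightarrow> ?N y \<subseteq> X"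
    have "parcs \<Gamma> \<subseteq> X \<times> Y \<union> Y \<times> X"
    proof
      fix e assume e: "e \<in> parcs \<Gamma>"
      then obtain x y where xy: "e = (x, y)" "x \<in> ?V" "y \<in> ?N x"
        using in_arcsD1 by (cases e) (auto simp: neighbours_def)
      then show "e \<in> X \<times> Y \<union> Y \<times> X" using XY(1) XY(3,4)[of x] by auto
    qed
    then show False using assms(5) XY(1,2) unfolding bipartite_graph_def by blast
  qed (use closed assms(1,2) \<alpha> in auto)
  have val: "card (?N x) \<le> kmax" if "x \<in> ?V" for x
    using that finite_V unfolding assms(6) max_valency_def
    by (auto simp: valency_eq_card_neighbours[symmetric])
  \<comment> \<open>Connectedness includes a nonempty vertex set, so \<open>Max\<close> is attained
    rather than unspecified.\<close>
  have "?V \<noteq> {}" using conn by (simp add: connected_conv)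
  then have "kmax \<in> valency \<Gamma> ` ?V"
    using finite_V unfolding assms(6) max_valency_def by (intro Max_in) auto
  then have ex: "\<exists>x\<in>?V. card (?N x) = kmax" by (auto simp: valency_eq_card_neighbours)
  have l: "l = min (1 - (\<theta>\<^sub>1 + 1) * (\<theta>\<^sub>2 + 1)) (1 - \<theta>\<^sub>1 * \<theta>\<^sub>2)"
    using assms(7) by (simp add: add.commute)
  note bounds = valency_and_order_bounds[OF val ex l]
  have "real kmax \<le> l\<^sup>2 - \<theta>\<^sub>1 * \<theta>\<^sub>2" if comp: "connected_graph (complement_graph \<Gamma>)"
  proof (rule bounds(2))
    fix S assume S: "S \<subseteq> ?V" "S \<noteq> {}"
      "\<And>x y. x \<in> S \<Longrightarrow> y \<in> ?V \<Longrightarrow> y \<notin> ?N x \<Longrightarrow> y \<in> S"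
    have "S = pverts (complement_graph \<Gamma>)"
    proof (rule connected_graph_closed_set[OF comp])
      fix x y assume x: "x \<in> S" and y: "y \<in> pverts (complement_graph \<Gamma>)"
        "(x, y) \<in> parcs (complement_graph \<Gamma>) \<or> (y, x) \<in> parcs (complement_graph \<Gamma>)"
      then have "y \<in> ?V" "y \<notin> ?N x"
        using N_sym[of x y] by (auto simp: complement_graph_def neighbours_def)
      then show "y \<in> S" using S(3) x by blast
    qed (use S in \<open>simp_all add: complement_graph_def\<close>)
    then show "S = ?V" by (simp add: complement_graph_def)
  qed
  then show ?thesis using bounds(1,3) assms(4) by simp
qed

end
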